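(* Let $\mathcal{A}$ be a complex Banach algebra with unity, $k$ a positive integer, and let $a,b\in\mathcal{A}$ both be g$\pi$-Hirano invertible. Suppose $ab\alpha_{1}\cdots\alpha_{k}=ba\alpha_{1}\cdots\alpha_{k}$ for all $\alpha_{1},\dots,\alpha_{k}\in\{a,b\}$. Then $1+a^{g\pi H}b$ is g$\pi$-Hirano invertible if and only if $a+b$ is g$\pi$-Hirano invertible.
   Context: $\mathcal{A}^{qnil}$ denotes the set of quasinilpotent elements of $\mathcal{A}$ (spectrum equal to $\{0\}$). An element $x\in\mathcal{A}$ is a g$\pi$-Hirano inverse of $a$ if $xax=x$, $ax=xa$ and $a-a^{n+2}x\in\mathcal{A}^{qnil}$ for some positive integer $n$; it is unique when it exists and is denoted $a^{g\pi H}$, and $a$ is then called g$\pi$-Hirano invertible. *)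

theory Defs
  imports "HOL-Analysis.Analysis"
begin

class complex_banach_algebra_1 = real_normed_algebra_1 + banach +
  fixes scaleC :: "complex \<Rightarrow> 'a \<Rightarrow> 'a"
  assumes scaleC_add_right: "scaleC c (x + y) = scaleC c x + scaleC c y"
    and scaleC_add_left: "scaleC (c + d) x = scaleC c x + scaleC d x"
    and scaleC_scaleC: "scaleC c (scaleC d x) = scaleC (c * d) x"
    and scaleC_one: "scaleC 1 x = x"
    and scaleR_scaleC: "scaleR r x = scaleC (complex_of_real r) x"
    and norm_scaleC: "norm (scaleC c x) = cmod c * norm x"
    and scaleC_mult_left: "scaleC c x * y = scaleC c (x * y)"
    and scaleC_mult_right: "x * scaleC c y = scaleC c (x * y)"

definition ba_invertible :: "'a::complex_banach_algebra_1 \<Rightarrow> bool" where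
  "ba_invertible x \<longleftrightarrow> (\<exists>y. y * x = 1 \<and> x * y = 1)"

definition ba_spectrum :: "'a::complex_banach_algebra_1 \<Rightarrow> complex set" where
  "ba_spectrum a = {z. \<not> ba_invertible (scaleC z 1 - a)}"

definition quasinilpotent :: "'a::complex_banach_algebra_1 \<Rightarrow> bool" where
  "quasinilpotent a \<longleftrightarrow> ba_spectrum a = {0}"

definition is_gpiH_inverse :: "'a::complex_banach_algebra_1 \<Rightarrow> 'a \<Rightarrow> bool" where
  "is_gpiH_inverse a x \<longleftrightarrow> x * a * x = x \<and> a * x = x * a \<and>
     (\<exists>n::nat. n > 0 \<and> quasinilpotent (a - a ^ (n + 2) * x))"

definition gpiH_invertible :: "'a::complex_banach_algebra_1 \<Rightarrow> bool" where
  "gpiH_invertible a \<longleftrightarrow> (\<exists>x. is_gpiH_inverse a x)"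

definition gpiH_inv :: "'a::complex_banach_algebra_1 \<Rightarrow> 'a" where
  "gpiH_inv a = (THE x. is_gpiH_inverse a x)"

end

(* An element is g-pi-Hirano invertible iff a - a^(n+1) is quasinilpotent for some n > 0
   ("quasiperiodic" below), i.e. iff its spectrum lies in {0} and the n-th roots of unity.  Let x be
   the inverse of a and p = a x.  The commutation hypothesis forces b p = p b p and a b p = b a p,
   so a + b and 1 + x b are triangular with respect to p, and a triangular element is quasiperiodic
   iff both of its diagonal corners are.  In the p-corner, (a + b) p = a (1 + x b) p and
   (1 + x b) p = x (a + b) p are products of commuting elements with a and x quasiperiodic.  In the
   (1 - p)-corner, 1 + x b is trivial and a is quasinilpotent; splitting once more along the
   idempotent of b reduces a + b to a commuting sum and a sum of two quasinilpotents.  The latter is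
   quasinilpotent because a and b commute when applied to (a + b)^k. *)
theory Submission
  imports Defs
begin

subsection \<open>Topological nilpotency\<close>

text \<open>Quasinilpotency is handled as the growth condition \<open>topnil\<close>: for every
  \<open>e > 0\<close> the powers are \<open>O(e ^ m)\<close>, so the spectral radius is zero. In
  this form commuting sums and products, cyclic rotation of a product and passage to a corner are
  norm estimates, and a corner such as \<open>y * p\<close> is judged inside the whole algebra. The
  price is the equivalence with spectrum \<open>{0}\<close>, whose hard direction is the spectral
  radius formula; it comes from dyadic averages of the resolvent instead of contour integrals. A
  second obstacle is recovering an inverse from quasiperiodicity: \<open>a ^ n\<close> is idempotent
  only up to a quasinilpotent error, so a true idempotent is built from an inverse square root
  series. The triangular form also rests on growth. Since \<open>p = a ^ k * x ^ k\<close>, the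
  hypothesis gives \<open>a * b * p = b * a * p\<close>; hence \<open>(1 - p) * b * p\<close> can be
  written with arbitrarily high powers of \<open>a\<close> next to \<open>1 - p\<close>, where
  \<open>a\<close> is quasinilpotent, and so it vanishes.\<close>

definition topnil :: "'a::real_normed_algebra_1 \<Rightarrow> bool" where
  "topnil x \<longleftrightarrow> (\<forall>e>0. \<exists>C. \<forall>m. norm (x ^ m) \<le> C * e ^ m)"

lemma power_mult_distrib_commuting:
  fixes x y :: "'a::monoid_mult"
  assumes "x * y = y * x"
  shows "(x * y) ^ m = x ^ m * y ^ m"
proof (induction m)
  case (Suc m)
  have "y * x ^ m = x ^ m * y"
    using power_commuting_commutes[OF assms] by simp
  then show ?case
    by (simp add: Suc mult.assoc) (metis mult.assoc)
qed simp

lemma topnilI_shift: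
  fixes x :: "'a::real_normed_algebra_1"
  assumes "\<And>e. e > 0 \<Longrightarrow> \<exists>C j. \<forall>m. norm (x ^ (m + j)) \<le> C * e ^ m"
  shows "topnil x"
  unfolding topnil_def
proof (intro allI impI)
  fix e :: real assume e: "e > 0"
  from assms[OF e] obtain C j where C: "\<And>m. norm (x ^ (m + j)) \<le> C * e ^ m" by blast
  have C0: "C \<ge> 0" using C[of 0] norm_ge_zero[of "x ^ j"] by (simp del: norm_ge_zero)
  \<comment> \<open>The sum pays for the exponents below \<open>j\<close>, the factor
    \<open>1 / e ^ j\<close> for the shift.\<close>
  define D where "D = C / e ^ j + (\<Sum>i<j. norm (x ^ i) / e ^ i)"
  have S0: "(\<Sum>i<j. norm (x ^ i) / e ^ i) \<ge> 0"
    using e by (intro sum_nonneg) simp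
  have "norm (x ^ m) \<le> D * e ^ m" for m
  proof (cases "m < j")
    case True
    have "norm (x ^ m) / e ^ m \<le> (\<Sum>i<j. norm (x ^ i) / e ^ i)"
      using True e by (intro member_le_sum) auto
    also have "\<dots> \<le> D" using C0 e by (simp add: D_def)
    finally show ?thesis using e by (simp add: divide_simps mult.commute)
  next
    case False
    then obtain i where m: "m = i + j" by (metis add.commute le_add_diff_inverse not_less)
    have "norm (x ^ m) \<le> C * e ^ i" using C m by simp
    also have "\<dots> = C / e ^ j * e ^ m" using e by (simp add: m power_add)
    also have "\<dots> \<le> D * e ^ m" using S0 e by (intro mult_right_mono) (auto simp: D_def)
    finally show ?thesis .
  qed
  then show "\<exists>C. \<forall>m. norm (x ^ m) \<le> C * e ^ m" by blast
qed

text \<open>The growth bound of \<open>x\<close> at rate \<open>e / K\<close> absorbs the factor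
  \<open>K ^ m\<close>. This is the comparison principle behind products, corners and cyclic
  rotation.\<close>

lemma topnil_dominated:
  fixes x y :: "'a::real_normed_algebra_1"
  assumes x: "topnil x" and K: "K > 0" "D \<ge> 0"
    and le: "\<And>m. norm (y ^ (m + j)) \<le> D * K ^ m * norm (x ^ m)"
  shows "topnil y"
proof (rule topnilI_shift)
  fix e :: real assume e: "e > 0"
  then have "e / K > 0" using K by simp
  then obtain C where C: "\<And>m. norm (x ^ m) \<le> C * (e / K) ^ m"
    using x unfolding topnil_def by meson
  have "norm (y ^ (m + j)) \<le> (D * C) * e ^ m" for m
  proof -
    have "norm (y ^ (m + j)) \<le> D * K ^ m * (C * (e / K) ^ m)"
      using le[of m] C[of m] K by (meson mult_left_mono order_trans zero_le_mult_iff zero_le_power less_imp_le)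
    also have "\<dots> = (D * C) * e ^ m" using K by (simp add: power_divide)
    finally show ?thesis .
  qed
  then show "\<exists>C j. \<forall>m. norm (y ^ (m + j)) \<le> C * e ^ m" by blast
qed

text \<open>At rate \<open>1 / (2 * K)\<close> the bound becomes a multiple of
  \<open>(1 / 2) ^ m\<close>, while \<open>z\<close> does not depend on \<open>m\<close>.\<close>

lemma topnil_vanish:
  fixes x z :: "'a::real_normed_algebra_1"
  assumes x: "topnil x" and K: "K > 0" "D \<ge> 0"
    and le: "\<And>m. norm z \<le> D * K ^ m * norm (x ^ m)"
  shows "z = 0"
proof -
  have "1 / (2 * K) > 0" using K by simp
  then obtain C where C: "\<And>m. norm (x ^ m) \<le> C * (1 / (2 * K)) ^ m"
    using x unfolding topnil_def by meson
  have "norm z \<le> (D * C) * (1 / 2) ^ m" for m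
  proof -
    have "norm z \<le> D * K ^ m * (C * (1 / (2 * K)) ^ m)"
      using le[of m] C[of m] K by (meson mult_left_mono order_trans zero_le_mult_iff zero_le_power less_imp_le)
    also have "\<dots> = (D * C) * (1 / 2) ^ m" using K by (simp add: power_divide power_mult_distrib)
    finally show ?thesis .
  qed
  moreover have "(\<lambda>m. (D * C) * (1 / 2 :: real) ^ m) \<longlonglongrightarrow> (D * C) * 0"
    by (intro tendsto_intros) (simp add: LIMSEQ_power_zero)
  ultimately have "norm z \<le> 0"
    by (metis (no_types, lifting) LIMSEQ_le_const mult_zero_right)
  then show ?thesis by simp
qed

lemma topnil_mult_commuting:
  fixes x y :: "'a::real_normed_algebra_1"
  assumes x: "topnil x" and c: "x * y = y * x"
  shows "topnil (x * y)"
\<comment> \<open>Adding 1 to \<open>norm y\<close> keeps \<open>K\<close> positive even for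
  \<open>y = 0\<close>.\<close>
proof (rule topnil_dominated[OF x, where j = 0 and D = 1 and K = "norm y + 1"])
  fix m
  have "norm ((x * y) ^ m) \<le> norm (x ^ m) * norm (y ^ m)"
    by (simp add: power_mult_distrib_commuting[OF c] norm_mult_ineq)
  also have "norm (y ^ m) \<le> (norm y + 1) ^ m"
    by (meson norm_power_ineq order_trans power_mono norm_ge_zero less_add_one less_imp_le)
  finally show "norm ((x * y) ^ (m + 0)) \<le> 1 * (norm y + 1) ^ m * norm (x ^ m)"
    by (simp add: mult_left_mono mult.commute[of _ "norm (x ^ m)"])
qed (auto intro: add_nonneg_pos)

lemma topnil_minus: "topnil x \<Longrightarrow> topnil (- x)" for x :: "'a::real_normed_algebra_1"
  using topnil_mult_commuting[of x "-1"] by simp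

lemma topnil_zero: "topnil (0 :: 'a::real_normed_algebra_1)"
  by (rule topnilI_shift) (auto intro!: exI[of _ 0] exI[of _ 1])

text \<open>The set \<open>V\<close> is a left module over the subalgebra generated by \<open>a\<close> and \<open>b\<close> on which
  these two elements commute, so that \<open>(a + b) ^ m\<close> expands binomially when applied to \<open>V\<close>.\<close>

lemma norm_power_add_module_le:
  fixes a b y :: "'a::real_normed_algebra_1"
  assumes V: "\<And>u. u \<in> V \<Longrightarrow> a * u \<in> V" "\<And>u. u \<in> V \<Longrightarrow> b * u \<in> V"
      "\<And>u v. u \<in> V \<Longrightarrow> v \<in> V \<Longrightarrow> u + v \<in> V"
    and comm: "\<And>u. u \<in> V \<Longrightarrow> a * b * u = b * a * u"
    and A: "\<And>i. norm (a ^ i) \<le> A * e ^ i" and B: "\<And>i. norm (b ^ i) \<le> B * e ^ i"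
    and e: "e > 0" and y: "y \<in> V"
  shows "norm (a ^ i * b ^ j * (a + b) ^ m * y) \<le> 2 ^ m * (A * B * norm y) * e ^ (i + j + m)"
\<comment> \<open>The prefix \<open>a ^ i * b ^ j\<close> collects the letters already pulled out of
  the power; each step doubles the number of terms, whence the factor \<open>2 ^ m\<close>.\<close>
proof (induction m arbitrary: i j)
  case 0
  have AB: "A * e ^ i \<ge> 0" "B * e ^ j \<ge> 0"
    using A[of i] B[of j] norm_ge_zero order_trans by blast+
  have "norm (a ^ i * b ^ j * y) \<le> norm (a ^ i) * norm (b ^ j) * norm y"
    by (meson mult_right_mono norm_ge_zero norm_mult_ineq order_trans)
  also have "\<dots> \<le> (A * e ^ i) * (B * e ^ j) * norm y"
    using A[of i] B[of j] AB by (intro mult_right_mono mult_mono) auto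
  finally show ?case by (simp add: power_add mult_ac)
next
  case (Suc m)
  define z where "z = (a + b) ^ m * y"
  have zV: "z \<in> V" unfolding z_def
  proof (induction m)
    case (Suc m)
    have "(a + b) ^ Suc m * y = a * ((a + b) ^ m * y) + b * ((a + b) ^ m * y)"
      by (simp add: algebra_simps)
    with Suc V show ?case by metis
  qed (simp add: y)
  have swap: "b ^ j * a * u = a * b ^ j * u" if "u \<in> V" for u
    using that
  proof (induction j arbitrary: u)
    case (Suc j)
    have "b ^ Suc j * a * u = b ^ j * (b * a * u)" by (simp only: power_Suc2 mult.assoc)
    also have "\<dots> = b ^ j * a * (b * u)" using comm Suc.prems by (simp add: mult.assoc)
    also have "\<dots> = a * b ^ j * (b * u)" using Suc V by blast
    also have "\<dots> = a * b ^ Suc j * u" by (simp add: power_Suc2 mult.assoc del: power_Suc)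
    finally show ?case .
  qed simp
  have "a ^ i * b ^ j * (a + b) ^ Suc m * y = a ^ i * (b ^ j * a * z) + a ^ i * b ^ Suc j * z"
    by (simp only: power_Suc2[of b j] power_Suc[of "a + b" m] z_def mult.assoc distrib_left distrib_right)
  also have "\<dots> = a ^ Suc i * b ^ j * (a + b) ^ m * y + a ^ i * b ^ Suc j * (a + b) ^ m * y"
    unfolding swap[OF zV] by (simp only: z_def mult.assoc power_Suc2[of a i])
  finally have "norm (a ^ i * b ^ j * (a + b) ^ Suc m * y)
      \<le> norm (a ^ Suc i * b ^ j * (a + b) ^ m * y) + norm (a ^ i * b ^ Suc j * (a + b) ^ m * y)"
    by (simp only: norm_triangle_ineq)
  also have "\<dots> \<le> 2 ^ m * (A * B * norm y) * e ^ (Suc i + j + m)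
      + 2 ^ m * (A * B * norm y) * e ^ (i + Suc j + m)"
    by (intro add_mono Suc)
  also have "\<dots> = 2 ^ Suc m * (A * B * norm y) * e ^ (i + j + Suc m)" by simp
  finally show ?case .
qed

text \<open>Rate \<open>e / 2\<close> for both summands compensates the \<open>2 ^ m\<close> terms
  of the expansion. It suffices that some power of \<open>a + b\<close> lies in \<open>V\<close>,
  because a fixed shift of the exponent is harmless.\<close>

lemma topnil_add_module:
  fixes a b :: "'a::real_normed_algebra_1"
  assumes a: "topnil a" and b: "topnil b"
    and V: "\<And>u. u \<in> V \<Longrightarrow> a * u \<in> V" "\<And>u. u \<in> V \<Longrightarrow> b * u \<in> V"
      "\<And>u v. u \<in> V \<Longrightarrow> v \<in> V \<Longrightarrow> u + v \<in> V"
    and comm: "\<And>u. u \<in> V \<Longrightarrow> a * b * u = b * a * u"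
    and y: "(a + b) ^ k \<in> V"
  shows "topnil (a + b)"
proof (rule topnilI_shift)
  fix e :: real assume "e > 0"
  then have e2: "e / 2 > 0" by simp
  obtain A where A: "\<And>m. norm (a ^ m) \<le> A * (e / 2) ^ m"
    using a e2 unfolding topnil_def by meson
  obtain B where B: "\<And>m. norm (b ^ m) \<le> B * (e / 2) ^ m"
    using b e2 unfolding topnil_def by meson
  have "norm ((a + b) ^ (m + k)) \<le> (A * B * norm ((a + b) ^ k)) * e ^ m" for m
    using norm_power_add_module_le[where V = V, OF V comm A B e2 y, of 0 0 m]
    by (simp add: power_add power_divide mult_ac)
  then show "\<exists>C j. \<forall>m. norm ((a + b) ^ (m + j)) \<le> C * e ^ m" by blast
qed

lemma topnil_add_commuting:
  fixes a b :: "'a::real_normed_algebra_1"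
  assumes "topnil a" "topnil b" "a * b = b * a"
  shows "topnil (a + b)"
  using assms by (intro topnil_add_module[where V = UNIV and k = 0]) auto

lemma topnil_not_invertible:
  fixes x y :: "'a::real_normed_algebra_1"
  assumes x: "topnil x" and c: "x * y = y * x"
  shows "x * y \<noteq> 1"
proof
  assume "x * y = 1"
  moreover have "topnil (x * y)" using topnil_mult_commuting[OF x c] .
  ultimately have "(1 :: 'a) = 0"
    by (intro topnil_vanish[where x = "1 :: 'a" and K = 1 and D = 1]) auto
  then show False by simp
qed

lemma topnil_summable:
  fixes x :: "'a::{real_normed_algebra_1, banach}"
  assumes x: "topnil x" and c: "\<And>n. \<bar>c n\<bar> \<le> K ^ n" and K: "K > 0"
  shows "summable (\<lambda>n. norm (c n *\<^sub>R x ^ n))"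
proof -
  have "1 / (2 * K) > 0" using K by simp
  then obtain C where C: "\<And>m. norm (x ^ m) \<le> C * (1 / (2 * K)) ^ m"
    using x unfolding topnil_def by meson
  have "norm (c n *\<^sub>R x ^ n) \<le> C * (1 / 2) ^ n" for n
  proof -
    have "norm (c n *\<^sub>R x ^ n) \<le> K ^ n * (C * (1 / (2 * K)) ^ n)"
      using c[of n] C[of n] K by (auto intro!: mult_mono)
    also have "\<dots> = C * (1 / 2) ^ n" using K by (simp add: power_divide power_mult_distrib)
    finally show ?thesis .
  qed
  moreover have "summable (\<lambda>n. C * (1 / 2 :: real) ^ n)"
    by (intro summable_mult summable_geometric) simp
  ultimately show ?thesis
    by (intro summable_comparison_test[OF _ \<open>summable (\<lambda>n. C * (1 / 2) ^ n)\<close>]) auto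
qed

lemma topnil_one_minus_inverse:
  fixes x :: "'a::{real_normed_algebra_1, banach}"
  assumes x: "topnil x"
  shows "(\<Sum>n. x ^ n) * (1 - x) = 1" "(1 - x) * (\<Sum>n. x ^ n) = 1"
proof -
  have s: "summable (\<lambda>n. x ^ n)"
    using topnil_summable[OF x, of "\<lambda>_. 1" 1] summable_norm_cancel by force
  have e: "(\<Sum>n. x ^ n) = 1 + (\<Sum>n. x ^ Suc n)"
    using suminf_split_head[OF s] by (simp add: algebra_simps)
  have "(\<Sum>n. x ^ Suc n) = x * (\<Sum>n. x ^ n)" "(\<Sum>n. x ^ Suc n) = (\<Sum>n. x ^ n) * x"
    using suminf_mult[OF s, of x] suminf_mult2[OF s, of x] by (simp_all add: power_commutes)
  with e show "(\<Sum>n. x ^ n) * (1 - x) = 1" "(1 - x) * (\<Sum>n. x ^ n) = 1"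
    by (simp_all add: algebra_simps)
qed

subsection \<open>The spectral radius and quasinilpotency\<close>

lemma scaleC_zero_left: "scaleC 0 x = (0 :: 'a::complex_banach_algebra_1)"
  using norm_scaleC[of 0 x] by simp

lemma scaleC_minus: "scaleC (- c) x = - scaleC c (x :: 'a::complex_banach_algebra_1)"
  using scaleC_add_left[of c "- c" x] by (simp add: scaleC_zero_left eq_neg_iff_add_eq_0 add.commute)

lemma scaleC_diff_left: "scaleC (c - d) x = scaleC c x - scaleC d (x :: 'a::complex_banach_algebra_1)"
  using scaleC_add_left[of c "- d" x] by (simp add: scaleC_minus)

lemma scaleC_diff_right: "scaleC c (x - y) = scaleC c x - scaleC c (y :: 'a::complex_banach_algebra_1)"
  using scaleC_add_right[of c "x - y" y] by (simp add: algebra_simps)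

lemma scaleC_power: "scaleC c x ^ m = scaleC (c ^ m) (x ^ m :: 'a::complex_banach_algebra_1)"
  by (induction m) (simp_all add: scaleC_one scaleC_mult_left scaleC_mult_right scaleC_scaleC mult.commute)

text \<open>The Neumann series of \<open>scaleC z x\<close> converges for every \<open>z\<close>.
  The form \<open>1 - z x\<close> of the resolvent is regular at \<open>z = 0\<close>, so the whole
  plane can be used.\<close>

lemma topnil_imp_resolvent:
  fixes x :: "'a::complex_banach_algebra_1"
  assumes "topnil x"
  shows "ba_invertible (1 - scaleC z x)"
proof -
  have "x * scaleC z 1 = scaleC z 1 * x" by (simp add: scaleC_mult_left scaleC_mult_right)
  from topnil_mult_commuting[OF assms this] have "topnil (scaleC z x)"
    by (simp add: scaleC_mult_right)
  then show ?thesis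
    unfolding ba_invertible_def using topnil_one_minus_inverse by blast
qed

text \<open>Translates between smallness of \<open>u\<close> and closeness of the inverse of
  \<open>1 - u\<close> to 1. The gap between \<open>1 / 4\<close> and \<open>1 / 2\<close> leaves
  room for a later perturbation of size \<open>1 / 4\<close>.\<close>

lemma inverse_norm_close:
  fixes u v :: "'a::real_normed_algebra_1"
  assumes "(1 - u) * v = 1"
  shows "norm u \<le> 1 / 5 \<Longrightarrow> norm (v - 1) \<le> 1 / 4"
    and "norm (v - 1) \<le> 1 / 2 \<Longrightarrow> norm u \<le> 1"
proof -
  have e: "v - 1 = u * (v - 1) + u" "u = (v - 1) - u * (v - 1)"
    using assms by (simp_all add: algebra_simps)
  have n: "norm (v - 1) \<le> norm u * norm (v - 1) + norm u"
    by (metis e(1) norm_triangle_mono norm_mult_ineq order_refl)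
  have n': "norm u \<le> norm (v - 1) + norm u * norm (v - 1)"
    by (metis e(2) norm_triangle_ineq4 norm_mult_ineq order_trans add_left_mono)
  {
    assume u: "norm u \<le> 1 / 5"
    then have "norm u * norm (v - 1) \<le> 1 / 5 * norm (v - 1)"
      by (intro mult_right_mono) auto
    with n u show "norm (v - 1) \<le> 1 / 4" by linarith
  }
  {
    assume u: "norm (v - 1) \<le> 1 / 2"
    then have "norm u * norm (v - 1) \<le> norm u * (1 / 2)"
      by (intro mult_left_mono) auto
    with n' u show "norm u \<le> 1" by linarith
  }
qed

lemma resolvent_diff:
  fixes x :: "'a::complex_banach_algebra_1"
  assumes "(1 - scaleC w x) * v = 1" "u * (1 - scaleC z x) = 1"
  shows "u - v = u * scaleC (z - w) x * v"
proof -
  have "u - v = u * ((1 - scaleC w x) * v) - (u * (1 - scaleC z x)) * v"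
    by (simp add: assms)
  also have "\<dots> = u * scaleC (z - w) x * v"
    by (simp add: algebra_simps scaleC_diff_left)
  finally show ?thesis .
qed

lemma resolvent_norm_diff:
  fixes x :: "'a::complex_banach_algebra_1"
  assumes "(1 - scaleC w x) * v = 1" "u * (1 - scaleC z x) = 1"
  shows "norm (u - v) \<le> norm u * (cmod (z - w) * norm x) * norm v"
proof -
  have "norm (u * scaleC (z - w) x * v) \<le> norm (u * scaleC (z - w) x) * norm v"
    by (rule norm_mult_ineq)
  also have "\<dots> \<le> (norm u * norm (scaleC (z - w) x)) * norm v"
    by (intro mult_right_mono norm_mult_ineq norm_ge_zero)
  finally show ?thesis
    by (simp only: resolvent_diff[OF assms] norm_scaleC)
qed

text \<open>The resolvent identity gives continuity, compactness of the disc then gives a uniform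
  bound \<open>M\<close>, and the identity applied once more gives the constant
  \<open>M * norm x * M\<close>.\<close>

lemma resolvent_lipschitz:
  fixes x :: "'a::complex_banach_algebra_1"
  assumes f: "\<And>z. f z * (1 - scaleC z x) = 1" "\<And>z. (1 - scaleC z x) * f z = 1"
  obtains L where "\<And>z w. cmod z \<le> R \<Longrightarrow> cmod w \<le> R \<Longrightarrow> norm (f z - f w) \<le> L * cmod (z - w)" "L \<ge> 0"
proof -
  have "isCont f w" for w
  proof -
    define q where "q = norm x * norm (f w)"
    have q0: "q \<ge> 0" by (simp add: q_def)
    have ev: "\<forall>\<^sub>F z in at w. cmod (z - w) * q < 1 / 2"
    proof -
      have "((\<lambda>z. cmod (z - w) * q) \<longlongrightarrow> cmod (w - w) * q) (at w)"
        by (intro tendsto_intros)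
      then show ?thesis by (rule order_tendstoD) simp
    qed
    have "\<forall>\<^sub>F z in at w. norm (f z - f w) \<le> 2 * norm (f w) * q * cmod (z - w)"
      using ev
    proof eventually_elim
      case (elim z)
      have d: "norm (f z - f w) \<le> norm (f z) * (cmod (z - w) * q)"
        using resolvent_norm_diff[OF f(2)[of w] f(1)[of z]] by (simp add: q_def mult_ac)
      also have "\<dots> \<le> norm (f z) * (1 / 2)"
        using elim by (intro mult_left_mono) auto
      \<comment> \<open>Near \<open>w\<close> the unknown \<open>norm (f z)\<close> on the right is
        absorbed by half of itself on the left.\<close>
      finally have "norm (f z) \<le> 2 * norm (f w)"
        using norm_triangle_ineq2[of "f z" "f w"] by linarith
      then have "norm (f z) * (cmod (z - w) * q) \<le> 2 * norm (f w) * (cmod (z - w) * q)"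
        using q0 by (intro mult_right_mono) auto
      with d show ?case by (simp add: mult_ac)
    qed
    moreover have "((\<lambda>z. 2 * norm (f w) * q * cmod (z - w)) \<longlongrightarrow> 0) (at w)"
      by (auto intro!: tendsto_eq_intros)
    ultimately have "((\<lambda>z. f z - f w) \<longlongrightarrow> 0) (at w)"
      by (rule Lim_null_comparison)
    then show ?thesis
      unfolding isCont_def by (simp add: LIM_zero_iff)
  qed
  then have "continuous_on (cball 0 R) f"
    by (simp add: continuous_at_imp_continuous_on)
  then have "bounded (f ` cball 0 R)"
    by (intro compact_imp_bounded compact_continuous_image) auto
  then obtain M where M: "\<And>z. cmod z \<le> R \<Longrightarrow> norm (f z) \<le> M" "M > 0"
    unfolding bounded_pos by (metis image_eqI mem_cball_0)
  show thesis
  proof (rule that[of "M * norm x * M"])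
    fix z w assume zw: "cmod z \<le> R" "cmod w \<le> R"
    have "norm (f z - f w) \<le> norm (f z) * (cmod (z - w) * norm x) * norm (f w)"
      by (rule resolvent_norm_diff[OF f(2) f(1)])
    also have "\<dots> \<le> M * (cmod (z - w) * norm x) * M"
      using M zw by (intro mult_mono mult_nonneg_nonneg) auto
    finally show "norm (f z - f w) \<le> M * norm x * M * cmod (z - w)" by (simp add: mult_ac)
  qed (use M in auto)
qed

text \<open>Partial fractions of \<open>1 / (1 - u * u)\<close>: one doubling step of the average
  over roots of unity.\<close>

lemma inverse_square_mean:
  fixes u y1 y2 :: "'a::real_normed_algebra_1"
  assumes "(1 - u) * y1 = 1" "(1 + u) * y2 = 1"
  shows "(1 - u * u) * ((1 / 2) *\<^sub>R (y1 + y2)) = 1"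
proof -
  have "(1 - u * u) * (y1 + y2) = (1 + u) * ((1 - u) * y1) + (1 - u) * ((1 + u) * y2)"
    by (simp add: algebra_simps)
  also have "\<dots> = 2" by (simp add: assms)
  finally have "(1 - u * u) * (y1 + y2) = 2 *\<^sub>R 1"
    by (metis scaleR_2 one_add_one)
  then show ?thesis by simp
qed

text \<open>Averaging the resolvent over the \<open>2 ^ j\<close>-th roots of unity yields the inverse of
  \<open>1 - (z x) ^ (2 ^ j)\<close>; the Lipschitz constant along rays does not depend on \<open>j\<close>.\<close>

lemma dyadic_resolvent_lipschitz:
  fixes x :: "'a::complex_banach_algebra_1"
  assumes inv: "\<And>z. (1 - scaleC z x) * f z = 1"
    and L: "\<And>z w. cmod z \<le> R \<Longrightarrow> cmod w \<le> R \<Longrightarrow> norm (f z - f w) \<le> L * cmod (z - w)"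
    and L0: "L \<ge> 0"
  obtains Y where "\<And>z. (1 - scaleC z x ^ (2 ^ j)) * Y z = 1"
    "\<And>z s. cmod z \<le> R \<Longrightarrow> 0 \<le> s \<Longrightarrow> s \<le> 1 \<Longrightarrow>
       norm (Y z - Y (of_real s * z)) \<le> L * ((1 - s) * cmod z)"
proof -
  have "\<exists>Y. (\<forall>z. (1 - scaleC z x ^ (2 ^ j)) * Y z = 1) \<and>
    (\<forall>z s. cmod z \<le> R \<longrightarrow> 0 \<le> s \<longrightarrow> s \<le> 1 \<longrightarrow>
       norm (Y z - Y (of_real s * z)) \<le> L * ((1 - s) * cmod z))"
  proof (induction j)
    case 0
    have "norm (f z - f (of_real s * z)) \<le> L * ((1 - s) * cmod z)"
      if "cmod z \<le> R" "0 \<le> s" "s \<le> 1" for z s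
    proof -
      have "cmod (of_real s * z) \<le> R"
        using that by (smt (verit) mult_left_le_one_le norm_ge_zero norm_mult norm_of_real)
      with L that have "norm (f z - f (of_real s * z)) \<le> L * cmod (z - of_real s * z)" by blast
      also have "z - of_real s * z = of_real (1 - s) * z" by (simp add: algebra_simps)
      also have "cmod (of_real (1 - s) * z) = (1 - s) * cmod z"
        using that by (simp only: norm_mult norm_of_real)
      finally show ?thesis .
    qed
    with inv show ?case by (intro exI[of _ f]) simp
  next
    case (Suc j)
    then obtain Y where Y: "\<And>z. (1 - scaleC z x ^ (2 ^ j)) * Y z = 1"
      "\<And>z s. cmod z \<le> R \<Longrightarrow> 0 \<le> s \<Longrightarrow> s \<le> 1 \<Longrightarrow>
         norm (Y z - Y (of_real s * z)) \<le> L * ((1 - s) * cmod z)" by blast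
    \<comment> \<open>A \<open>2 ^ j\<close>-th root of \<open>-1\<close> on the unit circle:
      rotating \<open>z\<close> by it turns \<open>1 - (z x) ^ (2 ^ j)\<close> into
      \<open>1 + (z x) ^ (2 ^ j)\<close> and maps rays to rays without changing lengths.\<close>
    define \<eta> where "\<eta> = cis (pi / 2 ^ j)"
    have \<eta>: "\<eta> ^ (2 ^ j) = - 1" "cmod \<eta> = 1"
      using Complex.DeMoivre[of "pi / 2 ^ j" "2 ^ j"] by (simp_all add: \<eta>_def)
    define Z where "Z z = (1 / 2) *\<^sub>R (Y z + Y (\<eta> * z))" for z
    have "(1 - scaleC z x ^ (2 ^ Suc j)) * Z z = 1" for z
    proof -
      have "(1 + scaleC z x ^ (2 ^ j)) * Y (\<eta> * z) = 1"
        using Y(1)[of "\<eta> * z"] by (simp add: scaleC_power power_mult_distrib \<eta> scaleC_minus)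
      from inverse_square_mean[OF Y(1) this] show ?thesis
        by (simp add: Z_def power_add[symmetric] mult_2)
    qed
    moreover have "norm (Z z - Z (of_real s * z)) \<le> L * ((1 - s) * cmod z)"
      if "cmod z \<le> R" "0 \<le> s" "s \<le> 1" for z s
    proof -
      have "Z z - Z (of_real s * z) = (1 / 2) *\<^sub>R
          ((Y z - Y (of_real s * z)) + (Y (\<eta> * z) - Y (of_real s * (\<eta> * z))))"
        by (simp add: Z_def algebra_simps)
      then have "norm (Z z - Z (of_real s * z)) \<le> 1 / 2 *
          (norm (Y z - Y (of_real s * z)) + norm (Y (\<eta> * z) - Y (of_real s * (\<eta> * z))))"
        by (simp add: norm_triangle_ineq)
      also have "\<dots> \<le> 1 / 2 * (L * ((1 - s) * cmod z) + L * ((1 - s) * cmod (\<eta> * z)))"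
        using that by (intro mult_left_mono add_mono Y(2)) (auto simp: norm_mult \<eta>)
      also have "\<dots> = L * ((1 - s) * cmod z)" by (simp add: norm_mult \<eta>)
      finally show ?thesis .
    qed
    ultimately show ?case by blast
  qed
  then show thesis using that by blast
qed

text \<open>Division of the exponent by \<open>N\<close> with remainder: one good power controls
  all, up to the finitely many remainders collected in \<open>C\<close>.\<close>

lemma topnilI_power_le:
  fixes x :: "'a::real_normed_algebra_1"
  assumes "\<And>e. e > 0 \<Longrightarrow> \<exists>N>0. norm (x ^ N) \<le> e ^ N"
  shows "topnil x"
  unfolding topnil_def
proof (intro allI impI)
  fix e :: real assume e: "e > 0"
  from assms[OF this] obtain N where N: "N > 0" "norm (x ^ N) \<le> e ^ N" by blast
  define C where "C = (\<Sum>r<N. norm (x ^ r) / e ^ r)"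
  have "norm (x ^ m) \<le> C * e ^ m" for m
  proof -
    define q r where "q = m div N" and "r = m mod N"
    have m: "m = N * q + r" and r: "r < N" using N by (simp_all add: q_def r_def)
    have "norm (x ^ m) \<le> norm (x ^ N) ^ q * norm (x ^ r)"
      unfolding m power_add power_mult
      by (meson mult_right_mono norm_ge_zero norm_mult_ineq norm_power_ineq order_trans)
    also have "\<dots> \<le> (e ^ N) ^ q * norm (x ^ r)"
      using N by (intro mult_right_mono power_mono) auto
    also have "\<dots> = (norm (x ^ r) / e ^ r) * e ^ m"
      using e by (simp add: m power_add power_mult)
    also have "\<dots> \<le> C * e ^ m"
      unfolding C_def using r e by (intro mult_right_mono member_le_sum) auto
    finally show ?thesis .
  qed
  then show "\<exists>C. \<forall>m. norm (x ^ m) \<le> C * e ^ m" by blast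
qed

text \<open>Elementary form of Gelfand's spectral radius formula: by the uniform Lipschitz bound,
  the convergence of \<open>(r x) ^ (2 ^ j)\<close> to \<open>0\<close> propagates from \<open>r\<close> to \<open>r + h\<close> for a fixed \<open>h\<close>.\<close>

lemma resolvent_imp_topnil:
  fixes x :: "'a::complex_banach_algebra_1"
  assumes "\<And>z. ba_invertible (1 - scaleC z x)"
  shows "topnil x"
proof (rule topnilI_power_le)
  fix e :: real assume e: "e > 0"
  from assms obtain f where f: "\<And>z. f z * (1 - scaleC z x) = 1" "\<And>z. (1 - scaleC z x) * f z = 1"
    unfolding ba_invertible_def by metis
  \<comment> \<open>At this radius \<open>norm ((R x) ^ N) < 1\<close> says exactly
    \<open>norm (x ^ N) < e ^ N\<close>.\<close>
  define R where "R = 1 / e"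
  have R: "R > 0" using e by (simp add: R_def)
  obtain L where L: "\<And>z w. cmod z \<le> 2 * R \<Longrightarrow> cmod w \<le> 2 * R \<Longrightarrow> norm (f z - f w) \<le> L * cmod (z - w)"
    and L0: "L \<ge> 0"
    using resolvent_lipschitz[OF f, of "2 * R"] by blast
  \<comment> \<open>The term \<open>8 * L * R\<close> makes the Lipschitz error over a distance
    \<open>2 * h\<close> at most \<open>1 / 4\<close>; the \<open>+ 1\<close> makes \<open>N\<close>
    positive.\<close>
  obtain N where N: "real N \<ge> 8 * L * R + 1" using real_arch_simple by blast
  then have N0: "N > 0" using L0 R by (smt (verit) mult_nonneg_nonneg of_nat_0_less_iff)
  define h where "h = R / N"
  have h: "h > 0" "h * N = R" using R N0 by (simp_all add: h_def)
  have Lh: "L * (2 * h) \<le> 1 / 4"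
    using N N0 by (simp add: h_def field_simps)
  define g where "g r j = r ^ (2 ^ j) * norm (x ^ (2 ^ j))" for r :: real and j :: nat
  have gn: "norm (scaleC (of_real r) x ^ (2 ^ j)) = g r j" if "r \<ge> 0" for r j
    using that by (simp add: g_def scaleC_power norm_scaleC norm_power)
  \<comment> \<open>The restriction on \<open>i\<close> keeps the radius \<open>r'\<close> used in
    the induction step within \<open>2 * R\<close>, where the Lipschitz bound holds.\<close>
  have conv: "i + 1 \<le> 2 * N \<Longrightarrow> g (i * h) \<longlonglongrightarrow> 0" for i :: nat
  proof (induction i)
    case 0
    then show ?case by (simp add: g_def zero_power)
  next
    case (Suc i)
    define r r' where "r = i * h" and "r' = r + 2 * h"
    have r: "r \<ge> 0" "r' > 0" using h by (auto simp: r_def r'_def add_nonneg_pos)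
    have "real (i + 2) * h \<le> real (2 * N) * h"
      using Suc.prems h by (intro mult_right_mono of_nat_mono) auto
    then have r'R: "r' \<le> 2 * R" using h(2) by (simp add: r_def r'_def algebra_simps)
    have "g r \<longlonglongrightarrow> 0" using Suc by (simp add: r_def)
    then have "\<forall>\<^sub>F j in sequentially. g r j < 1 / 5"
      by (rule order_tendstoD) simp
    then have ev: "\<forall>\<^sub>F j in sequentially. g r' j \<le> 1"
    proof eventually_elim
      case (elim j)
      obtain Y where Y: "\<And>z. (1 - scaleC z x ^ (2 ^ j)) * Y z = 1"
        "\<And>z s. cmod z \<le> 2 * R \<Longrightarrow> 0 \<le> s \<Longrightarrow> s \<le> 1 \<Longrightarrow>
          norm (Y z - Y (of_real s * z)) \<le> L * ((1 - s) * cmod z)"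
        using dyadic_resolvent_lipschitz[where R = "2 * R" and j = j, OF f(2) L L0] by blast
      have "norm (Y (of_real r) - 1) \<le> 1 / 4"
        using inverse_norm_close(1)[OF Y(1)[of "of_real r"]] elim gn[of r j] r by simp
      moreover have "norm (Y (of_real r') - Y (of_real r)) \<le> 1 / 4"
      proof -
        have cm: "cmod (of_real r') = r'" using r by simp
        have "norm (Y (of_real r') - Y (of_real (r / r') * of_real r')) \<le> L * ((1 - r / r') * cmod (of_real r'))"
          using r r'R h by (intro Y(2)) (simp_all add: cm, simp add: r'_def)
        also have "of_real (r / r') * of_real r' = (of_real r :: complex)" using r by simp
        also have "(1 - r / r') * cmod (of_real r') = 2 * h"
          using r unfolding cm by (simp add: field_simps) (simp add: r'_def algebra_simps)
        finally show ?thesis using Lh by linarith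
      qed
      ultimately have "norm (Y (of_real r') - 1) \<le> 1 / 2"
        using norm_triangle_ineq[of "Y (of_real r') - Y (of_real r)" "Y (of_real r) - 1"] by simp
      then show ?case
        using inverse_norm_close(2)[OF Y(1)[of "of_real r'"]] gn[of r' j] r by simp
    qed
    \<comment> \<open>At \<open>r'\<close> only boundedness by 1 is known; retreating from
      \<open>r' = r + 2 * h\<close> to \<open>r + h\<close> gains the factor
      \<open>\<rho> ^ (2 ^ j)\<close>, which tends to 0.\<close>
    define \<rho> where "\<rho> = (r + h) / r'"
    have \<rho>: "0 \<le> \<rho>" "\<rho> < 1" using r h by (simp_all add: \<rho>_def r'_def)
    have "\<forall>\<^sub>F j in sequentially. norm (g (r + h) j) \<le> \<rho> ^ (2 ^ j)"
      using ev
    proof eventually_elim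
      case (elim j)
      have "g (r + h) j = \<rho> ^ (2 ^ j) * g r' j"
        using r by (simp add: g_def \<rho>_def power_divide)
      also have "\<dots> \<le> \<rho> ^ (2 ^ j)" using elim \<rho> by (intro mult_left_le) auto
      finally show ?case using gn[of "r + h" j] r h by (simp add: g_def)
    qed
    moreover have "(\<lambda>j::nat. \<rho> ^ (2 ^ j)) \<longlonglongrightarrow> 0"
    proof -
      have "strict_mono (\<lambda>j. 2 ^ j :: nat)" by (simp add: strict_mono_def)
      from LIMSEQ_subseq_LIMSEQ[OF LIMSEQ_power_zero[of \<rho>] this] show ?thesis
        using \<rho> by (simp add: o_def)
    qed
    ultimately have "g (r + h) \<longlonglongrightarrow> 0" by (rule Lim_null_comparison)
    then show ?case by (simp add: r_def algebra_simps)
  qed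
  have "g R \<longlonglongrightarrow> 0" using conv[of N] N0 h by (simp add: mult.commute)
  then have "\<forall>\<^sub>F j in sequentially. g R j < 1" by (rule order_tendstoD) simp
  then obtain j where "g R j < 1" by (metis eventually_sequentially order_refl)
  then have "norm (x ^ (2 ^ j)) / e ^ (2 ^ j) < 1"
    by (simp add: g_def R_def power_inverse divide_inverse mult.commute)
  then have "norm (x ^ (2 ^ j)) \<le> e ^ (2 ^ j)"
    using e by (simp add: divide_less_eq)
  moreover have "0 < (2 ^ j :: nat)" by simp
  ultimately show "\<exists>N>0. norm (x ^ N) \<le> e ^ N" by blast
qed

section \<open>Spectrum \<open>{0}\<close> and topological nilpotency\<close>

lemma ba_invertible_mult:
  assumes "ba_invertible x" "ba_invertible y"
  shows "ba_invertible (x * y)"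
proof -
  obtain x' y' where "x' * x = 1" "x * x' = 1" "y' * y = 1" "y * y' = 1"
    using assms unfolding ba_invertible_def by blast
  moreover have "(y' * x') * (x * y) = y' * (x' * x) * y" "(x * y) * (y' * x') = x * (y * y') * x'"
    by (simp_all only: mult.assoc)
  ultimately have "(y' * x') * (x * y) = 1" "(x * y) * (y' * x') = 1" by simp_all
  then show ?thesis unfolding ba_invertible_def by blast
qed

lemma ba_invertible_scaleC:
  assumes "c \<noteq> 0" "ba_invertible x"
  shows "ba_invertible (scaleC c x)"
proof -
  have "ba_invertible (scaleC c (1 :: 'a))"
    unfolding ba_invertible_def using assms
    by (intro exI[of _ "scaleC (1 / c) 1"]) (simp add: scaleC_mult_left scaleC_scaleC scaleC_one)
  from ba_invertible_mult[OF this assms(2)] show ?thesis by (simp add: scaleC_mult_left)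
qed

text \<open>For \<open>z\<close> nonzero, \<open>z - x\<close> is \<open>z\<close> times the
  resolvent at \<open>1 / z\<close>. The spectrum must equal \<open>{0}\<close>, so the converse
  also shows that \<open>x\<close> itself is not invertible.\<close>

lemma quasinilpotent_iff_topnil: "quasinilpotent x \<longleftrightarrow> topnil x"
proof
  assume q: "quasinilpotent x"
  show "topnil x"
  proof (rule resolvent_imp_topnil)
    fix z
    show "ba_invertible (1 - scaleC z x)"
    proof (cases "z = 0")
      case True
      then show ?thesis by (simp add: scaleC_zero_left ba_invertible_def)
    next
      case False
      then have "1 / z \<notin> ba_spectrum x"
        using q by (simp add: quasinilpotent_def)
      then have "ba_invertible (scaleC (1 / z) 1 - x)"
        by (simp add: ba_spectrum_def)
      from ba_invertible_scaleC[OF False this] False show ?thesis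
        by (simp add: scaleC_diff_right scaleC_scaleC scaleC_one)
    qed
  qed
next
  assume t: "topnil x"
  have "ba_invertible (scaleC z 1 - x) \<longleftrightarrow> z \<noteq> 0" for z
  proof (cases "z = 0")
    case True
    have "\<not> ba_invertible (- x)"
    proof
      assume "ba_invertible (- x)"
      then obtain y where "y * - x = 1" "- x * y = 1" unfolding ba_invertible_def by blast
      with topnil_not_invertible[OF topnil_minus[OF t], of y] show False by metis
    qed
    then show ?thesis using True by (simp add: scaleC_zero_left)
  next
    case False
    with ba_invertible_scaleC[OF False topnil_imp_resolvent[OF t, of "1 / z"]] show ?thesis
      by (simp add: scaleC_diff_right scaleC_scaleC scaleC_one)
  qed
  then show "quasinilpotent x" by (simp add: quasinilpotent_def ba_spectrum_def)
qed

text \<open>Since \<open>u * v = 0\<close>, the element \<open>1 - z (u + v)\<close> factors as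
  \<open>(1 - z u) (1 - z v)\<close>. The summands need not commute, which is why resolvents replace
  the binomial expansion here.\<close>

lemma topnil_add_annihilating:
  fixes u v :: "'a::complex_banach_algebra_1"
  assumes "topnil u" "topnil v" "u * v = 0"
  shows "topnil (u + v)"
proof (rule resolvent_imp_topnil)
  fix z
  have "scaleC z 0 = (0 :: 'a)" using norm_scaleC[of z "0 :: 'a"] by simp
  then have "scaleC z u * scaleC z v = 0"
    by (simp add: scaleC_mult_left scaleC_mult_right assms(3))
  then have "(1 - scaleC z u) * (1 - scaleC z v) = 1 - (scaleC z u + scaleC z v)"
    by (simp add: left_diff_distrib right_diff_distrib)
  moreover have "ba_invertible ((1 - scaleC z u) * (1 - scaleC z v))"
    using assms by (intro ba_invertible_mult topnil_imp_resolvent)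
  ultimately show "ba_invertible (1 - scaleC z (u + v))"
    by (simp only: scaleC_add_right)
qed

subsection \<open>Lifting idempotents\<close>

definition commute :: "'a::semigroup_mult \<Rightarrow> 'a \<Rightarrow> bool" where
  "commute x y \<longleftrightarrow> x * y = y * x"

lemma commuteD: "commute x y \<Longrightarrow> x * y = y * x"
  by (simp add: commute_def)

lemma commute_sym: "commute x y \<Longrightarrow> commute y x"
  by (simp add: commute_def)

lemma commute_refl: "commute x x"
  by (simp add: commute_def)

lemma commute_one: "commute x (1 :: 'a::monoid_mult)"
  by (simp add: commute_def)

lemma commute_mult: "commute x y \<Longrightarrow> commute x z \<Longrightarrow> commute x (y * z)"
  unfolding commute_def by (metis mult.assoc)

lemma commute_power: "commute x y \<Longrightarrow> commute x (y ^ m)" for x :: "'a::monoid_mult"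
  by (induction m) (simp_all add: commute_one commute_mult)

lemma commute_add: "commute x y \<Longrightarrow> commute x z \<Longrightarrow> commute x (y + z)" for x :: "'a::ring_1"
  by (simp add: commute_def algebra_simps)

lemma commute_diff: "commute x y \<Longrightarrow> commute x z \<Longrightarrow> commute x (y - z)" for x :: "'a::ring_1"
  by (simp add: commute_def algebra_simps)

lemma commute_minus: "commute x y \<Longrightarrow> commute x (- y)" for x :: "'a::ring_1"
  by (simp add: commute_def)

lemma commute_scaleR: "commute x y \<Longrightarrow> commute x (c *\<^sub>R y)" for x :: "'a::real_normed_algebra_1"
  by (simp add: commute_def)

lemmas commute_right = commute_refl commute_one commute_mult commute_power commute_add
  commute_diff commute_minus commute_scaleR

lemmas commute_intros = commute_right commute_right[THEN commute_sym]

lemma commute_inverse: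
  fixes x :: "'a::monoid_mult"
  assumes "commute x y" "w * y = 1" "y * w = 1"
  shows "commute x w"
proof -
  have "x * w = w * (y * x) * w" by (simp add: assms flip: mult.assoc)
  also have "\<dots> = w * (x * y) * w" using assms(1) by (simp add: commute_def)
  also have "\<dots> = w * x * (y * w)" by (simp only: mult.assoc)
  finally show ?thesis by (simp add: assms commute_def)
qed

lemma topnil_mult_commute:
  fixes x y :: "'a::real_normed_algebra_1"
  shows "topnil x \<Longrightarrow> commute x y \<Longrightarrow> topnil (x * y)"
  unfolding commute_def by (rule topnil_mult_commuting)

lemma topnil_add_commute:
  fixes x y :: "'a::real_normed_algebra_1"
  shows "topnil x \<Longrightarrow> topnil y \<Longrightarrow> commute x y \<Longrightarrow> topnil (x + y)"
  unfolding commute_def by (rule topnil_add_commuting)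

lemma abs_gchoose_minus_half_le: "\<bar>(- 1 / 2 :: real) gchoose n\<bar> \<le> 1"
proof (induction n)
  case (Suc n)
  have "((- 1 / 2 :: real) gchoose Suc n) = ((- 1 / 2) gchoose n) * ((- 1 / 2 - real n) / (real n + 1))"
    by (simp add: gbinomial_prod_rev field_simps)
  moreover have "\<bar>(- 1 / 2 - real n) / (real n + 1)\<bar> \<le> 1" by (simp add: abs_if field_simps)
  ultimately show ?case
    using Suc by (simp only: abs_mult) (intro mult_le_one; simp)
qed simp

text \<open>Coefficientwise form of the fact that \<open>(1 + X) ^ (-1/2)\<close> squares to
  \<open>(1 + X) ^ (-1)\<close>.\<close>

lemma gchoose_minus_half_convolution:
  "(\<Sum>i\<le>k. ((- 1 / 2 :: real) gchoose i) * ((- 1 / 2) gchoose (k - i))) = (- 1) ^ k"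
proof -
  have "(\<Sum>i\<le>k. ((- 1 / 2 :: real) gchoose i) * ((- 1 / 2) gchoose (k - i))) = (- 1) gchoose k"
    using gbinomial_Vandermonde[of "- 1 / 2 :: real" "- 1 / 2" k] by (simp add: atLeast0AtMost)
  also have "\<dots> = (- 1) ^ k"
    using gbinomial_minus[of "1 :: real" k] binomial_gbinomial[of k k, where 'a = real] by simp
  finally show ?thesis .
qed

text \<open>The idempotent is \<open>1/2 + (e - 1/2) (1 - 4 t) ^ (-1/2)\<close> with \<open>t = e - e\<^sup>2\<close>, since
  \<open>(2 e - 1)\<^sup>2 = 1 - 4 t\<close>.\<close>

lemma topnil_idempotent_lift:
  fixes e :: "'a::{real_normed_algebra_1, banach}"
  assumes t: "topnil (e - e * e)"
  obtains p where "p * p = p" "topnil (e - p)" "\<And>a. commute a e \<Longrightarrow> commute a p"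
proof -
  define t where "t = e - e * e"
  \<comment> \<open>Coefficients of \<open>(1 - 4 X) ^ (-1/2)\<close>, so \<open>S\<close> below is
    the inverse square root of \<open>1 - 4 t\<close>.\<close>
  define c where "c n = ((- 1 / 2 :: real) gchoose n) * (- 4) ^ n" for n
  have tn: "topnil t" using assms by (simp add: t_def)
  have c4: "\<bar>c n\<bar> \<le> 4 ^ n" for n
    using mult_right_mono[OF abs_gchoose_minus_half_le, of "4 ^ n" n] by (simp add: c_def abs_mult power_abs)
  have sn: "summable (\<lambda>n. norm (c n *\<^sub>R t ^ n))"
    using topnil_summable[OF tn c4] by simp
  then have s: "summable (\<lambda>n. c n *\<^sub>R t ^ n)" by (rule summable_norm_cancel)
  define S where "S = (\<Sum>n. c n *\<^sub>R t ^ n)"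
  have comm_series: "commute a (\<Sum>n. d n *\<^sub>R t ^ n)"
    if "commute a t" "summable (\<lambda>n. d n *\<^sub>R t ^ n)" for a and d :: "nat \<Rightarrow> real"
  proof -
    have "a * (d n *\<^sub>R t ^ n) = (d n *\<^sub>R t ^ n) * a" for n
      using that(1) by (intro commuteD commute_right)
    then show ?thesis
      unfolding commute_def suminf_mult[OF that(2), symmetric] suminf_mult2[OF that(2)] by (simp only:)
  qed
  have "c 0 = 1" by (simp add: c_def)
  have S1: "S = 1 + t * (\<Sum>n. c (Suc n) *\<^sub>R t ^ n)" and sS: "summable (\<lambda>n. c (Suc n) *\<^sub>R t ^ n)"
  proof -
    \<comment> \<open>The summability criterion asks for a bound \<open>K ^ n\<close> without a
      constant; dividing the shifted coefficients by 16 produces one.\<close>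
    have "\<bar>c (Suc n)\<bar> \<le> 16 ^ Suc n" for n
      using c4[of "Suc n"] power_mono[of 4 "16 :: real" "Suc n"] by simp
    then have "\<bar>c (Suc n) / 16\<bar> \<le> 16 ^ n" for n by (simp add: field_simps)
    then have "summable (\<lambda>n. norm ((c (Suc n) / 16) *\<^sub>R t ^ n))"
      by (rule topnil_summable[OF tn]) simp
    from summable_scaleR_right[OF summable_norm_cancel[OF this], of 16]
    show sS: "summable (\<lambda>n. c (Suc n) *\<^sub>R t ^ n)" by simp
    have "S = 1 + (\<Sum>n. c (Suc n) *\<^sub>R t ^ Suc n)"
      using suminf_split_head[OF s] by (simp add: S_def algebra_simps \<open>c 0 = 1\<close>)
    then show "S = 1 + t * (\<Sum>n. c (Suc n) *\<^sub>R t ^ n)"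
      by (simp add: suminf_mult[OF sS, symmetric])
  qed
  have "topnil (S - 1)"
    unfolding S1 using topnil_mult_commute[OF tn comm_series[OF commute_refl sS]] by simp
  have comm_t: "commute a t" if "commute a e" for a
    unfolding t_def using that by (intro commute_right)
  have comm_S: "commute a S" if "commute a e" for a
    unfolding S_def using comm_t[OF that] s by (rule comm_series)
  have SS: "(1 - 4 *\<^sub>R t) * (S * S) = 1"
  proof -
    have "S * S = (\<Sum>k. \<Sum>i\<le>k. (c i *\<^sub>R t ^ i) * (c (k - i) *\<^sub>R t ^ (k - i)))"
      unfolding S_def by (rule Cauchy_product[OF sn sn])
    also have "\<dots> = (\<Sum>k. (4 *\<^sub>R t) ^ k)"
    proof (rule suminf_cong)
      fix k
      have "(\<Sum>i\<le>k. (c i *\<^sub>R t ^ i) * (c (k - i) *\<^sub>R t ^ (k - i))) = (\<Sum>i\<le>k. (c i * c (k - i)) *\<^sub>R t ^ k)"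
        by (intro sum.cong refl) (simp flip: power_add)
      also have "\<dots> = (\<Sum>i\<le>k. c i * c (k - i)) *\<^sub>R t ^ k" by (simp add: scaleR_sum_left)
      also have "(\<Sum>i\<le>k. c i * c (k - i)) =
          (\<Sum>i\<le>k. (- 4) ^ k * (((- 1 / 2) gchoose i) * ((- 1 / 2) gchoose (k - i))))"
      proof (intro sum.cong refl)
        fix i assume "i \<in> {..k}"
        then have "(- 4 :: real) ^ k = (- 4) ^ i * (- 4) ^ (k - i)" by (simp flip: power_add)
        then show "c i * c (k - i) = (- 4) ^ k * (((- 1 / 2) gchoose i) * ((- 1 / 2) gchoose (k - i)))"
          by (simp add: c_def)
      qed
      also have "\<dots> = (- 4) ^ k * (- 1) ^ k"
        by (simp only: sum_distrib_left[symmetric] gchoose_minus_half_convolution)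
      also have "\<dots> = (4 :: real) ^ k" by (simp flip: power_mult_distrib)
      finally show "(\<Sum>i\<le>k. (c i *\<^sub>R t ^ i) * (c (k - i) *\<^sub>R t ^ (k - i))) = (4 *\<^sub>R t) ^ k"
        by (simp add: scaleR_power)
    qed
    finally show ?thesis
      using topnil_one_minus_inverse(2)[of "4 *\<^sub>R t"] topnil_mult_commute[OF tn, of "4 *\<^sub>R 1"]
      by (simp add: commute_def)
  qed
  define f where "f = 2 *\<^sub>R e - 1"
  have ff: "f * f = 1 - 4 *\<^sub>R t"
  proof -
    have "4 *\<^sub>R z = (z + z) + (z + z)" for z :: 'a
      using scaleR_scaleR[of 2 2 z] by (simp add: scaleR_2 del: scaleR_scaleR)
    then show ?thesis by (simp add: f_def t_def algebra_simps scaleR_2)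
  qed
  have "commute f S" unfolding f_def by (intro comm_S commute_intros)
  \<comment> \<open>\<open>f * S\<close> is an involution, so half of \<open>1 + f * S\<close> is
    idempotent.\<close>
  then have fS: "f * S * (f * S) = 1"
    using SS unfolding ff[symmetric] by (metis commuteD mult.assoc)
  define p where "p = (1 / 2) *\<^sub>R (1 + f * S)"
  have "p * p = p"
  proof -
    have "(1 + f * S) * (1 + f * S) = 2 *\<^sub>R (1 + f * S)"
      by (simp only: distrib_left distrib_right fS mult_1_left mult_1_right scaleR_2) (simp add: add_ac)
    then show ?thesis by (simp add: p_def)
  qed
  moreover have "topnil (e - p)"
  proof -
    have "e - p = (S - 1) * ((- 1 / 2) *\<^sub>R f)"
    proof -
      have "f * S = S * f" using \<open>commute f S\<close> by (rule commuteD)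
      then have "p = (1 / 2) *\<^sub>R (1 + S * f)" by (simp add: p_def)
      moreover have "e = (1 / 2) *\<^sub>R (1 + f)" by (simp add: f_def)
      ultimately have "e - p = (1 / 2) *\<^sub>R (f - S * f)"
        by (simp only: scaleR_diff_right[symmetric]) simp
      then show ?thesis by (simp add: left_diff_distrib scaleR_diff_right)
    qed
    moreover have "commute (S - 1) ((- 1 / 2) *\<^sub>R f)"
      using commute_sym[OF \<open>commute f S\<close>] by (intro commute_scaleR commute_diff[THEN commute_sym] commute_one) (rule commute_sym)
    ultimately show ?thesis using topnil_mult_commute[OF \<open>topnil (S - 1)\<close>] by metis
  qed
  moreover have "commute a p" if "commute a e" for a
    unfolding p_def f_def using comm_S[OF that] that by (intro commute_right)
  ultimately show thesis using that by blast
qed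

subsection \<open>Quasiperiodic elements\<close>

definition quasiperiodic :: "'a::real_normed_algebra_1 \<Rightarrow> bool" where
  "quasiperiodic y \<longleftrightarrow> (\<exists>n>0. topnil (y - y ^ (n + 1)))"

text \<open>Passing to multiples of the exponent lets two quasiperiodic elements share one, namely
  the product of their exponents.\<close>

lemma quasiperiodic_multiple:
  fixes y :: "'a::real_normed_algebra_1"
  assumes "topnil (y - y ^ (n + 1))"
  shows "topnil (y - y ^ (j * n + 1))"
proof (induction j)
  case 0
  then show ?case by (simp add: topnil_zero)
next
  case (Suc j)
  have "topnil ((y - y ^ (n + 1)) + (y - y ^ (j * n + 1)) * y ^ n)"
    using assms Suc by (intro topnil_add_commute topnil_mult_commute commute_intros)
  also have "(y - y ^ (n + 1)) + (y - y ^ (j * n + 1)) * y ^ n = y - y ^ (Suc j * n + 1)"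
    by (simp add: left_diff_distrib power_add[symmetric] mult.assoc ac_simps)
  finally show ?case .
qed

lemma quasiperiodic_common:
  fixes u v :: "'a::real_normed_algebra_1"
  assumes "quasiperiodic u" "quasiperiodic v"
  obtains n where "n > 0" "topnil (u - u ^ (n + 1))" "topnil (v - v ^ (n + 1))"
proof -
  obtain m n where "m > 0" "n > 0" "topnil (u - u ^ (m + 1))" "topnil (v - v ^ (n + 1))"
    using assms unfolding quasiperiodic_def by blast
  then show thesis
    using that[of "n * m"] quasiperiodic_multiple[of u m n] quasiperiodic_multiple[of v n m]
    by (simp add: mult.commute)
qed

text \<open>With a common exponent the defect telescopes: \<open>u v - (u v) ^ (n + 1)\<close> is
  \<open>(u - u ^ (n + 1)) v + (v - v ^ (n + 1)) u ^ (n + 1)\<close>.\<close>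

lemma quasiperiodic_mult:
  fixes u v :: "'a::real_normed_algebra_1"
  assumes "quasiperiodic u" "quasiperiodic v" and c: "commute u v"
  shows "quasiperiodic (u * v)"
proof -
  obtain n where n: "n > 0" "topnil (u - u ^ (n + 1))" "topnil (v - v ^ (n + 1))"
    using quasiperiodic_common[OF assms(1,2)] .
  have c': "commute v u" using c by (rule commute_sym)
  have "topnil ((u - u ^ (n + 1)) * v + (v - v ^ (n + 1)) * u ^ (n + 1))"
    using n c c' by (intro topnil_add_commute topnil_mult_commute commute_intros)
  also have "(u - u ^ (n + 1)) * v + (v - v ^ (n + 1)) * u ^ (n + 1) = u * v - (u * v) ^ (n + 1)"
  proof -
    have "commute v (u ^ (n + 1))" "commute (u ^ (n + 1)) (v ^ (n + 1))"
      by (intro commute_intros c c')+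
    then show ?thesis
      using power_mult_distrib_commuting[OF commuteD[OF c], of "n + 1"]
      by (simp only: left_diff_distrib commute_def) simp
  qed
  finally show ?thesis using n(1) unfolding quasiperiodic_def by blast
qed

text \<open>Every mixed binomial term contains a factor \<open>v\<close>; only the commutation of
  the cofactor \<open>h\<close> matters later, not its value.\<close>

lemma power_add_commute:
  fixes u v :: "'a::ring_1"
  assumes c: "commute u v"
  shows "\<exists>h. (u + v) ^ n = u ^ n + v * h \<and> commute h u \<and> commute h v"
proof (induction n)
  case 0
  show ?case by (intro exI[of _ 0]) (simp add: commute_def)
next
  case (Suc n)
  then obtain h where h: "(u + v) ^ n = u ^ n + v * h" "commute h u" "commute h v" by blast
  have c': "commute v u" "commute u h" "commute v h" using c h by (auto intro: commute_sym)
  have "(u + v) ^ Suc n = (u + v) * (u ^ n + v * h)" by (simp add: h)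
  also have "\<dots> = u ^ Suc n + v * (u ^ n + (u + v) * h)"
    using commuteD[OF c] by (simp add: algebra_simps) (metis mult.assoc)
  finally show ?case
    by (intro exI[of _ "u ^ n + (u + v) * h"] conjI) (assumption | intro commute_intros h c c')+
qed

lemma quasiperiodic_add_topnil:
  fixes u v :: "'a::real_normed_algebra_1"
  assumes u: "quasiperiodic u" and v: "topnil v" and c: "commute u v"
  shows "quasiperiodic (u + v)"
proof -
  obtain n where n: "n > 0" "topnil (u - u ^ (n + 1))" using u unfolding quasiperiodic_def by blast
  obtain h where h: "(u + v) ^ (n + 1) = u ^ (n + 1) + v * h" "commute h u" "commute h v"
    using power_add_commute[OF c] by blast
  have c': "commute v u" "commute u h" "commute v h"
    using c h(2,3) by (auto intro: commute_sym)
  have "topnil ((u - u ^ (n + 1)) + v * (1 - h))"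
    using n v c c' h(2,3) by (intro topnil_add_commute topnil_mult_commute commute_intros)
  also have "(u - u ^ (n + 1)) + v * (1 - h) = (u + v) - (u + v) ^ (n + 1)"
    unfolding h(1) by (simp add: algebra_simps)
  finally show ?thesis using n(1) unfolding quasiperiodic_def by blast
qed

lemma topnil_imp_quasiperiodic:
  fixes v :: "'a::real_normed_algebra_1"
  assumes "topnil v"
  shows "quasiperiodic v"
proof -
  have "quasiperiodic (0 :: 'a)"
    unfolding quasiperiodic_def by (intro exI[of _ 1]) (simp add: topnil_zero)
  from quasiperiodic_add_topnil[OF this assms] show ?thesis by (simp add: commute_def)
qed

lemma idempotent_imp_quasiperiodic:
  fixes p :: "'a::real_normed_algebra_1"
  shows "p * p = p \<Longrightarrow> quasiperiodic p"
  unfolding quasiperiodic_def by (intro exI[of _ 1]) (simp add: topnil_zero)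

section \<open>Corners and triangular elements\<close>

text \<open>The condition lets every \<open>p\<close> be absorbed by the one to its right. The
  exponent is a successor because for exponent 0 the two sides are 1 and \<open>p\<close>.\<close>

lemma power_corner_right:
  fixes y :: "'a::monoid_mult"
  assumes "p * y * p = y * p"
  shows "(y * p) ^ Suc m = y ^ Suc m * p"
proof (induction m)
  case (Suc m)
  have "(y * p) ^ Suc (Suc m) = y ^ Suc m * (p * y * p)"
    by (simp only: power_Suc2[of "y * p" "Suc m"] Suc mult.assoc)
  then show ?case unfolding assms by (simp only: power_Suc2[of y "Suc m"] mult.assoc)
qed simp

lemma power_corner_left:
  fixes y :: "'a::monoid_mult"
  assumes "r * y * r = r * y"
  shows "(r * y) ^ Suc m = r * y ^ Suc m"
proof (induction m)
  case (Suc m)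
  have "(r * y) ^ Suc (Suc m) = (r * y * r) * y ^ Suc m"
    by (simp only: power_Suc[of "r * y" "Suc m"] Suc mult.assoc)
  then show ?case unfolding assms by (simp only: power_Suc[of y "Suc m"] mult.assoc)
qed simp

lemma topnil_corner_right:
  fixes y :: "'a::real_normed_algebra_1"
  assumes y: "topnil y" and p: "p * y * p = y * p"
  shows "topnil (y * p)"
proof (rule topnil_dominated[OF y, where j = 1 and K = 1 and D = "norm y * norm p"])
  fix m
  have "norm ((y * p) ^ (m + 1)) \<le> norm (y ^ Suc m) * norm p"
    using power_corner_right[OF p, of m] by (simp add: norm_mult_ineq del: power_Suc)
  also have "\<dots> \<le> (norm y * norm (y ^ m)) * norm p"
    by (intro mult_right_mono) (simp_all add: norm_mult_ineq)
  finally show "norm ((y * p) ^ (m + 1)) \<le> norm y * norm p * 1 ^ m * norm (y ^ m)"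
    by (simp add: mult_ac)
qed auto

lemma topnil_corner_left:
  fixes y :: "'a::real_normed_algebra_1"
  assumes y: "topnil y" and r: "r * y * r = r * y"
  shows "topnil (r * y)"
proof (rule topnil_dominated[OF y, where j = 1 and K = 1 and D = "norm r * norm y"])
  fix m
  have "norm ((r * y) ^ (m + 1)) \<le> norm r * norm (y ^ Suc m)"
    using power_corner_left[OF r, of m] by (simp add: norm_mult_ineq del: power_Suc)
  also have "\<dots> \<le> norm r * (norm y * norm (y ^ m))"
    by (intro mult_left_mono) (simp_all add: norm_mult_ineq)
  finally show "norm ((r * y) ^ (m + 1)) \<le> norm r * norm y * 1 ^ m * norm (y ^ m)"
    by (simp add: mult_ac)
qed auto

text \<open>Regrouping gives \<open>(v u) ^ (m + 1) = v (u v) ^ m u\<close>.\<close>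

lemma topnil_swap:
  fixes u v :: "'a::real_normed_algebra_1"
  assumes "topnil (u * v)"
  shows "topnil (v * u)"
proof (rule topnil_dominated[OF assms, where j = 1 and K = 1 and D = "norm v * norm u"])
  fix m
  have "(v * u) ^ (m + 1) = v * (u * v) ^ m * u"
    by (induction m) (simp_all add: mult.assoc)
  then have "norm ((v * u) ^ (m + 1)) \<le> norm (v * (u * v) ^ m) * norm u"
    by (simp only: norm_mult_ineq)
  also have "\<dots> \<le> norm v * norm ((u * v) ^ m) * norm u"
    by (intro mult_right_mono) (simp_all add: norm_mult_ineq)
  finally show "norm ((v * u) ^ (m + 1)) \<le> norm v * norm u * 1 ^ m * norm ((u * v) ^ m)"
    by (simp add: mult_ac)
qed auto

text \<open>Splits \<open>y\<close> as \<open>y * (1 - p) + y * p\<close>; the product in this order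
  is zero by triangularity, and the first summand is a cyclic rotation of
  \<open>(1 - p) * y\<close>.\<close>

lemma topnil_triangular:
  fixes y :: "'a::complex_banach_algebra_1"
  assumes p: "p * p = p" "p * y * p = y * p"
    and t: "topnil (y * p)" "topnil ((1 - p) * y)"
  shows "topnil y"
proof -
  have "y * (1 - p) * (y * p) = 0"
    using p(2) by (simp add: algebra_simps)
  from topnil_add_annihilating[OF topnil_swap[OF t(2)] t(1) this] show ?thesis
    by (simp add: algebra_simps)
qed

text \<open>The defect \<open>y - y ^ (n + 1)\<close> is again triangular, and its corners are the
  defects of the corners of \<open>y\<close>, so the question reduces to topological
  nilpotency.\<close>

lemma quasiperiodic_triangular:
  fixes y :: "'a::complex_banach_algebra_1"
  assumes p: "p * p = p" "p * y * p = y * p"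
  shows "quasiperiodic y \<longleftrightarrow> quasiperiodic (y * p) \<and> quasiperiodic ((1 - p) * y)"
proof -
  define r where "r = 1 - p"
  have corner: "r * g * r = r * g" if "p * g * p = g * p" for g
    using that by (simp add: r_def algebra_simps)
  have r: "r * y * r = r * y" using corner[OF p(2)] .
  have yp: "(y - y ^ (n + 1)) * p = y * p - (y * p) ^ (n + 1)" for n
    using power_corner_right[OF p(2), of n] by (simp add: left_diff_distrib del: power_Suc)
  have ry: "r * (y - y ^ (n + 1)) = r * y - (r * y) ^ (n + 1)" for n
    using power_corner_left[OF r, of n] by (simp add: right_diff_distrib del: power_Suc)
  have pm: "p * y ^ m * p = y ^ m * p" for m
  proof (induction m)
    case (Suc m)
    have "p * y ^ Suc m * p = p * y * (y ^ m * p)" by (simp add: mult.assoc)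
    also have "\<dots> = p * y * p * (y ^ m * p)" unfolding Suc[symmetric] by (simp add: mult.assoc)
       (metis mult.assoc p(1))
    also have "\<dots> = y * (p * y ^ m * p)" unfolding p(2) by (simp add: mult.assoc)
    finally show ?case unfolding Suc by (simp add: mult.assoc)
  qed (simp add: p)
  have pf: "p * (y - y ^ (n + 1)) * p = (y - y ^ (n + 1)) * p" for n
    by (simp only: left_diff_distrib right_diff_distrib pm p(2))
  have rf: "r * (y - y ^ (n + 1)) * r = r * (y - y ^ (n + 1))" for n
    using corner[OF pf] .
  show ?thesis unfolding r_def[symmetric]
  proof (intro iffI conjI)
    assume "quasiperiodic y"
    then obtain n where n: "n > 0" "topnil (y - y ^ (n + 1))" unfolding quasiperiodic_def by blast
    show "quasiperiodic (y * p)"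
      using topnil_corner_right[OF n(2) pf] n(1) unfolding yp quasiperiodic_def by blast
    show "quasiperiodic (r * y)"
      using topnil_corner_left[OF n(2) rf] n(1) unfolding ry quasiperiodic_def by blast
  next
    assume "quasiperiodic (y * p) \<and> quasiperiodic (r * y)"
    then obtain n where n: "n > 0" "topnil (y * p - (y * p) ^ (n + 1))" "topnil (r * y - (r * y) ^ (n + 1))"
      using quasiperiodic_common by blast
    then have "topnil (y - y ^ (n + 1))"
      using topnil_triangular[OF p(1) pf] unfolding yp ry r_def[symmetric] by blast
    with n(1) show "quasiperiodic y" unfolding quasiperiodic_def by blast
  qed
qed

subsection \<open>Generalized Hirano inverses\<close>

lemma gpiH_inverse_idempotent:
  assumes "is_gpiH_inverse a x"
  shows "(a * x) * (a * x) = a * x" "x * (a * x) = x" "a * x * x = x" "commute a x"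
proof -
  have e: "x * a * x = x" "a * x = x * a" using assms by (auto simp: is_gpiH_inverse_def)
  then show "commute a x" "x * (a * x) = x" "a * x * x = x"
    by (simp_all add: commute_def mult.assoc)
  then show "(a * x) * (a * x) = a * x" by (simp add: mult.assoc)
qed

lemma idempotent_power:
  fixes p :: "'a::monoid_mult"
  assumes "p * p = p"
  shows "p ^ m * p = p" "p * p ^ m = p"
proof -
  show "p ^ m * p = p" by (induction m) (simp_all add: assms mult.assoc)
  then show "p * p ^ m = p" by (simp add: power_commutes)
qed

lemma gpiH_inverse_powers:
  assumes "is_gpiH_inverse a x"
  shows "a ^ m * x ^ m * (a * x) = a * x" and "x ^ m * a ^ m * (a * x) = a * x"
    and "a ^ Suc m * x ^ Suc m = a * x"
proof -
  note i = gpiH_inverse_idempotent[OF assms]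
  have e: "a ^ m * x ^ m = (a * x) ^ m" "x ^ m * a ^ m = (a * x) ^ m" for m
    using power_mult_distrib_commuting[OF commuteD[OF i(4)], of m]
      power_mult_distrib_commuting[OF commuteD[OF i(4)[THEN commute_sym]], of m] commuteD[OF i(4)]
    by simp_all
  show "a ^ m * x ^ m * (a * x) = a * x" "x ^ m * a ^ m * (a * x) = a * x"
    unfolding e by (rule idempotent_power(1)[OF i(1)])+
  show "a ^ Suc m * x ^ Suc m = a * x"
    by (simp only: e[of "Suc m"] power_Suc2[of "a * x" m] idempotent_power(1)[OF i(1)])
qed

text \<open>Let \<open>d = a - a ^ (n + 2) * x\<close>. Then
  \<open>d * (1 - a * x) = a * (1 - a * x)\<close>, subtracting
  \<open>a * (1 - a * x) * a ^ n\<close> from \<open>d\<close> leaves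
  \<open>a - a ^ (n + 1)\<close>, and \<open>d * x ^ (n + 2) = x ^ (n + 1) - x\<close>.\<close>

lemma gpiH_inverse_topnil:
  assumes "is_gpiH_inverse a x"
  shows "topnil (a * (1 - a * x))" and "quasiperiodic a" and "quasiperiodic x"
proof -
  note i = gpiH_inverse_idempotent[OF assms]
  have ca: "commute a x" "commute x a" using i(4) by (auto intro: commute_sym)
  obtain n where n: "n > 0" "topnil (a - a ^ (n + 2) * x)"
    using assms by (auto simp: is_gpiH_inverse_def quasinilpotent_iff_topnil)
  have "topnil ((a - a ^ (n + 2) * x) * (1 - a * x))"
    using n ca by (intro topnil_mult_commute commute_intros)
  also have "(a - a ^ (n + 2) * x) * (1 - a * x) = a * (1 - a * x) - a ^ (n + 2) * (x - x * (a * x))"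
    by (simp only: left_diff_distrib right_diff_distrib mult_1_right mult.assoc) simp
  finally show q: "topnil (a * (1 - a * x))" by (simp only: i(2)) simp
  have "topnil ((a - a ^ (n + 2) * x) + - (a * (1 - a * x) * a ^ n))"
    by (intro topnil_add_commute[OF n(2)] topnil_minus topnil_mult_commute[OF q] commute_intros ca)
  also have "(a - a ^ (n + 2) * x) + - (a * (1 - a * x) * a ^ n) = a - a ^ (n + 1)"
  proof -
    have "a * (a * x) * a ^ n = a ^ (n + 2) * x"
    proof -
      have "commute x (a ^ n)" using ca by (intro commute_intros)
      then have "a * (a * x) * a ^ n = a * (a * a ^ n) * x" by (simp add: commute_def mult.assoc)
      then show ?thesis by simp
    qed
    then show ?thesis by (simp add: left_diff_distrib right_diff_distrib)
  qed
  finally show "quasiperiodic a" using n(1) unfolding quasiperiodic_def by blast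
  have "topnil ((a - a ^ (n + 2) * x) * x ^ (n + 2))"
    using n ca by (intro topnil_mult_commute commute_intros)
  also have "(a - a ^ (n + 2) * x) * x ^ (n + 2) = - (x - x ^ (n + 1))"
  proof -
    have "a * x ^ (n + 2) = (a * x * x) * x ^ n" by (simp add: mult.assoc)
    also have "\<dots> = x ^ (n + 1)" by (simp add: i(3))
    finally have 1: "a * x ^ (n + 2) = x ^ (n + 1)" .
    have "a ^ (n + 2) * x * x ^ (n + 2) = (a ^ Suc (n + 1) * x ^ Suc (n + 1)) * x"
      by (simp add: mult.assoc power_commutes)
    also have "\<dots> = x" by (simp only: gpiH_inverse_powers(3)[OF assms] i(3))
    finally show ?thesis using 1 by (simp only: left_diff_distrib) simp
  qed
  finally have "topnil (x - x ^ (n + 1))" using topnil_minus by fastforce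
  then show "quasiperiodic x" using n(1) unfolding quasiperiodic_def by blast
qed

section \<open>Vanishing corners and uniqueness of the inverse\<close>

lemma norm_mult_power_le:
  fixes u v w c x :: "'a::real_normed_algebra_1"
  shows "norm (u * w ^ m * v * x ^ m * c) \<le> (norm u * norm v * norm c) * (norm x + 1) ^ m * norm (w ^ m)"
proof -
  have "norm (u * w ^ m * v * x ^ m * c) \<le> norm (u * w ^ m * v * x ^ m) * norm c"
    by (rule norm_mult_ineq)
  also have "\<dots> \<le> (norm (u * w ^ m * v) * norm (x ^ m)) * norm c"
    by (intro mult_right_mono norm_mult_ineq norm_ge_zero)
  also have "\<dots> \<le> ((norm (u * w ^ m) * norm v) * norm (x ^ m)) * norm c"
    by (intro mult_right_mono norm_mult_ineq norm_ge_zero)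
  also have "\<dots> \<le> (((norm u * norm (w ^ m)) * norm v) * norm (x ^ m)) * norm c"
    by (intro mult_right_mono norm_mult_ineq norm_ge_zero)
  also have "\<dots> \<le> (((norm u * norm (w ^ m)) * norm v) * (norm x + 1) ^ m) * norm c"
  proof (intro mult_right_mono mult_left_mono)
    show "norm (x ^ m) \<le> (norm x + 1) ^ m"
      by (rule order_trans[OF norm_power_ineq power_mono]) auto
  qed auto
  finally show ?thesis by (simp only: mult_ac)
qed

lemma power_mult_idempotent:
  fixes a :: "'a::monoid_mult"
  assumes "e * e = e" "commute a e"
  shows "(a * e) ^ m * e = a ^ m * e" "e * (a * e) ^ m = e * a ^ m"
proof -
  note p = idempotent_power[OF assms(1)]
  have c: "commute e (a ^ m)" using assms(2) by (intro commute_intros) (rule commute_sym)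
  show "(a * e) ^ m * e = a ^ m * e"
    using p by (simp add: power_mult_distrib_commuting[OF commuteD[OF assms(2)]] mult.assoc)
  have "e * (a ^ m * e ^ m) = a ^ m * (e * e ^ m)"
    using commuteD[OF c] by (simp add: mult.assoc[symmetric])
  then show "e * (a * e) ^ m = e * a ^ m"
    using p commuteD[OF c] by (simp add: power_mult_distrib_commuting[OF commuteD[OF assms(2)]])
qed

text \<open>As \<open>z p = a ^ m z x ^ m p\<close> for all \<open>m\<close>, the quasinilpotency of \<open>a e\<close> forces \<open>e z p = 0\<close>.\<close>

lemma topnil_corner_vanish:
  assumes x: "is_gpiH_inverse a x" and e: "e * e = e" "commute a e" "topnil (a * e)"
    and z: "a * z * (a * x) = z * a * (a * x)"
  shows "e * z * (a * x) = 0"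
proof -
  note i = gpiH_inverse_idempotent[OF x]
  define p where "p = a * x"
  have cp: "commute p x" unfolding p_def using i(4) by (intro commute_intros) (auto intro: commute_sym)
  have zp: "z * p = a ^ m * z * x ^ m * p" for m
  proof (induction m)
    case (Suc m)
    have "p * x ^ m = x ^ m * p" using cp by (intro commuteD commute_power)
    then have "a ^ m * z * x ^ m * p = a ^ m * (z * p) * x ^ m" by (simp add: mult.assoc)
    also have "z * p = (z * a * p) * x"
      unfolding p_def using i(1) i(4) by (simp add: commute_def mult.assoc)
    also have "\<dots> = (a * z * p) * x" using z by (simp add: p_def)
    also have "a ^ m * (a * z * p * x) * x ^ m = a ^ Suc m * z * (p * x ^ Suc m)"
      by (simp only: power_Suc2[of a m] power_Suc[of x m] mult.assoc)
    also have "p * x ^ Suc m = x ^ Suc m * p" using cp by (intro commuteD commute_power)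
    finally show ?case using Suc by (simp add: mult.assoc)
  qed simp
  have "norm (e * z * p) \<le> (norm e * norm z * norm p) * (norm x + 1) ^ m * norm ((a * e) ^ m)" for m
  proof -
    have "e * z * p = e * a ^ m * z * x ^ m * p" using zp[of m] by (simp only: mult.assoc)
    also have "e * a ^ m = e * (a * e) ^ m" using power_mult_idempotent(2)[OF e(1,2)] by simp
    finally show ?thesis using norm_mult_power_le[of e "a * e" m z x p] by simp
  qed
  from topnil_vanish[OF e(3) _ _ this] show ?thesis
    by (simp add: p_def add_nonneg_pos)
qed

text \<open>Mirror image of the previous argument, based on
  \<open>p = p * x ^ m * a ^ m\<close>.\<close>

lemma topnil_corner_vanish_right:
  assumes x: "is_gpiH_inverse a x" and e: "e * e = e" "commute a e" "topnil (a * e)"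
  shows "(a * x) * e = 0"
proof -
  note i = gpiH_inverse_idempotent[OF x]
  define p where "p = a * x"
  have "norm (p * e) \<le> (norm e * norm p * 1) * (norm x + 1) ^ m * norm ((a * e) ^ m)" for m
  proof -
    have "commute p (x ^ m * a ^ m)" unfolding p_def
      using i(4) by (intro commute_intros) (auto intro: commute_sym)
    then have "p = p * x ^ m * a ^ m"
      using gpiH_inverse_powers(2)[OF x, of m] by (simp add: p_def commute_def mult.assoc)
    then have "p * e = p * x ^ m * ((a * e) ^ m * e)"
      unfolding power_mult_idempotent(1)[OF e(1,2)] by (metis mult.assoc)
    then have "norm (p * e) \<le> norm (p * x ^ m) * norm ((a * e) ^ m * e)"
      by (simp only: norm_mult_ineq)
    also have "\<dots> \<le> (norm p * norm (x ^ m)) * (norm ((a * e) ^ m) * norm e)"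
      by (intro mult_mono norm_mult_ineq) auto
    also have "\<dots> \<le> (norm p * (norm x + 1) ^ m) * (norm ((a * e) ^ m) * norm e)"
    proof (intro mult_right_mono mult_left_mono)
      show "norm (x ^ m) \<le> (norm x + 1) ^ m"
        by (rule order_trans[OF norm_power_ineq power_mono]) auto
    qed auto
    finally show ?thesis by (simp only: mult_ac mult_1_right)
  qed
  from topnil_vanish[OF e(3) _ _ this] show ?thesis
    by (simp add: p_def add_nonneg_pos)
qed

text \<open>For two inverses \<open>u\<close>, \<open>v\<close> the idempotent \<open>a * u\<close>
  annihilates \<open>1 - a * v\<close> on both sides, because \<open>a\<close> is quasinilpotent
  there. By symmetry the idempotents agree, and they determine the inverse.\<close>

lemma gpiH_inverse_unique:
  assumes x: "is_gpiH_inverse a x" and y: "is_gpiH_inverse a y"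
  shows "x = y"
proof -
  have le: "(a * u) * (a * v) = a * u" "(a * v) * (a * u) = a * u"
    if u: "is_gpiH_inverse a u" and v: "is_gpiH_inverse a v" for u v
  proof -
    note i = gpiH_inverse_idempotent[OF v]
    have e: "(1 - a * v) * (1 - a * v) = 1 - a * v" "commute a (1 - a * v)"
      using i(1) by (simp_all add: algebra_simps) (use i(4) in \<open>intro commute_intros\<close>)
    note t = gpiH_inverse_topnil(1)[OF v]
    show "(a * u) * (a * v) = a * u"
      using topnil_corner_vanish_right[OF u e t] by (simp add: right_diff_distrib)
    show "(a * v) * (a * u) = a * u"
      using topnil_corner_vanish[OF u e t, of 1] by (simp add: left_diff_distrib)
  qed
  have p: "a * x = a * y" using le(1)[OF x y] le(2)[OF y x] by simp
  have "x = x * (a * x)" using gpiH_inverse_idempotent(2)[OF x] by simp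
  also have "\<dots> = (x * a) * y" by (simp only: p mult.assoc)
  also have "x * a = a * x" using commuteD[OF gpiH_inverse_idempotent(4)[OF x]] by simp
  also have "(a * x) * y = (a * y) * y" by (simp only: p)
  also have "\<dots> = y" by (rule gpiH_inverse_idempotent(3)[OF y])
  finally show ?thesis .
qed

lemma gpiH_inv_inverse: "gpiH_invertible a \<Longrightarrow> is_gpiH_inverse a (gpiH_inv a)"
  unfolding gpiH_invertible_def gpiH_inv_def
  by (rule theI', rule ex_ex1I) (auto intro: gpiH_inverse_unique)

text \<open>With \<open>n = Suc k\<close>, the power \<open>e = a ^ n\<close> is close to an
  idempotent \<open>p\<close> and hence invertible in the \<open>p\<close>-corner; since
  \<open>a * a ^ k = e\<close>, this inverts \<open>a\<close> there as well.\<close>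

lemma quasiperiodic_imp_gpiH_invertible:
  assumes "quasiperiodic a"
  shows "gpiH_invertible a"
proof -
  obtain k where k: "topnil (a - a ^ (Suc k + 1))"
    using assms unfolding quasiperiodic_def by (metis gr0_implies_Suc)
  define e where "e = a ^ Suc k"
  have "topnil ((a - a ^ (Suc k + 1)) * a ^ k)"
    using k by (intro topnil_mult_commute commute_intros)
  also have "(a - a ^ (Suc k + 1)) * a ^ k = e - e * e"
    by (simp only: e_def left_diff_distrib flip: power_add power_Suc) simp
  finally have "topnil (e - e * e)" .
  then obtain p where p: "p * p = p" "topnil (e - p)" and cp: "\<And>c. commute c e \<Longrightarrow> commute c p"
    using topnil_idempotent_lift by blast
  have ae: "commute a e" unfolding e_def by (intro commute_intros)
  have ap: "commute a p" "commute p a" using cp[OF ae] by (auto intro: commute_sym)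
  have ep: "commute e p" "commute p e" unfolding e_def by (intro commute_intros ap)+
  have tp: "topnil ((p - e) * p)"
    using topnil_minus[OF p(2)] ep by (intro topnil_mult_commute commute_intros) simp_all
  \<comment> \<open>A perturbation of 1, invertible in the whole algebra, that agrees with
    \<open>e\<close> on the \<open>p\<close>-corner.\<close>
  define g where "g = 1 - (p - e) * p"
  define w where "w = (\<Sum>n. ((p - e) * p) ^ n)"
  have w: "w * g = 1" "g * w = 1"
    unfolding g_def w_def by (rule topnil_one_minus_inverse[OF tp])+
  have "commute a g" unfolding g_def using ap ae by (intro commute_intros)
  then have aw: "commute a w" using w by (rule commute_inverse)
  have "commute p g" unfolding g_def using ep by (intro commute_intros)
  then have pw: "commute p w" "commute w p" using w commute_inverse commute_sym by blast+
  have gp: "g * p = e * p" using p(1) by (simp add: g_def left_diff_distrib mult.assoc)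
  define x where "x = a ^ k * p * w"
  have ax: "a * x = p"
  proof -
    have "a * x = (e * p) * w" by (simp add: x_def e_def mult.assoc)
    also have "\<dots> = g * (p * w)" by (simp only: gp[symmetric] mult.assoc)
    also have "\<dots> = (g * w) * p" by (simp only: commuteD[OF pw(1)] mult.assoc)
    finally show ?thesis by (simp add: w)
  qed
  have cax: "commute a x" unfolding x_def using ap aw by (intro commute_intros)
  have "x * a * x = x"
  proof -
    have "x * p = a ^ k * (p * p) * w" by (simp only: x_def mult.assoc commuteD[OF pw(2)])
    then have "x * (a * x) = x" by (simp only: ax p(1)) (simp add: x_def)
    then show ?thesis by (simp add: mult.assoc)
  qed
  moreover have "topnil (a - a ^ (Suc k + 2) * x)"
  proof -
    have e1: "a ^ (Suc k + 2) * x = a * e * p"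
    proof -
      have "a ^ (Suc k + 2) * x = a ^ (Suc k + 1) * (a * x)"
        using power_Suc2[of a "Suc k + 1"] by (simp only: add_Suc_right numeral_2_eq_2 mult.assoc One_nat_def)
      then show ?thesis by (simp add: ax e_def)
    qed
    have "topnil ((a - a ^ (Suc k + 1)) + (e - p) * ((1 - p) * a))"
      using k p(2) ap ep ae unfolding e_def
      by (intro topnil_add_commute topnil_mult_commute commute_intros)
    also have "(a - a ^ (Suc k + 1)) + (e - p) * ((1 - p) * a) = a - a ^ (Suc k + 2) * x"
    proof -
      have "(e - p) * ((1 - p) * a) = e * a - e * p * a"
        using p(1) by (simp add: left_diff_distrib right_diff_distrib flip: mult.assoc)
      moreover have "e * a = a ^ (Suc k + 1)" by (simp add: e_def power_Suc2 del: power_Suc)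
      moreover have "e * p * a = a * e * p"
        using commuteD[OF ap(1)] commuteD[OF ae] by (simp add: mult.assoc)
      ultimately show ?thesis unfolding e1 by simp
    qed
    finally show ?thesis .
  qed
  ultimately have "is_gpiH_inverse a x"
    unfolding is_gpiH_inverse_def quasinilpotent_iff_topnil using commuteD[OF cax] by blast
  then show ?thesis unfolding gpiH_invertible_def by blast
qed

lemma gpiH_invertible_iff_quasiperiodic: "gpiH_invertible a \<longleftrightarrow> quasiperiodic a"
  using quasiperiodic_imp_gpiH_invertible gpiH_inverse_topnil(2) gpiH_invertible_def by blast

subsection \<open>Commutation on words\<close>

definition word_commuting :: "nat \<Rightarrow> 'a::monoid_mult \<Rightarrow> 'a \<Rightarrow> bool" where
  "word_commuting k a b \<longleftrightarrow>
    (\<forall>w. length w = k \<and> set w \<subseteq> {a, b} \<longrightarrow> a * b * prod_list w = b * a * prod_list w)"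

lemma word_commuting_sym: "word_commuting k a b \<Longrightarrow> word_commuting k b a"
  unfolding word_commuting_def by (auto simp: insert_commute)

text \<open>Behind a leading \<open>r\<close>, all further factors \<open>r\<close> in a word can be
  deleted, so words in \<open>r * a\<close>, \<open>r * b\<close> reduce to words in
  \<open>a\<close>, \<open>b\<close>.\<close>

lemma word_commuting_corner:
  fixes a b r :: "'a::monoid_mult"
  assumes w: "word_commuting k a b" and r: "r * r = r" "r * a * r = r * a" "r * b * r = r * b"
  shows "word_commuting k (r * a) (r * b)"
  unfolding word_commuting_def
proof (intro allI impI)
  fix v assume v: "length v = k \<and> set v \<subseteq> {r * a, r * b}"
  have "\<exists>u. length u = length v \<and> set u \<subseteq> {a, b} \<and> r * prod_list v = r * prod_list u"
    using conjunct2[OF v]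
  proof (induction v)
    case (Cons y v)
    then obtain u where u: "length u = length v" "set u \<subseteq> {a, b}" "r * prod_list v = r * prod_list u"
      by auto
    from Cons.prems obtain c where c: "c \<in> {a, b}" "y = r * c" by auto
    have rc: "r * c * r = r * c" using c r by auto
    have "r * prod_list (y # v) = (r * r) * c * prod_list v" by (simp add: c mult.assoc)
    also have "\<dots> = (r * c * r) * prod_list v" by (simp only: r rc)
    also have "\<dots> = (r * c * r) * prod_list u" using u(3) by (simp only: mult.assoc)
    also have "\<dots> = r * prod_list (c # u)" unfolding rc by (simp add: mult.assoc)
    finally show ?case using u c by (intro exI[of _ "c # u"]) auto
  qed simp
  then obtain u where u: "length u = length v" "set u \<subseteq> {a, b}" "r * prod_list v = r * prod_list u"
    by blast
  have "r * c * (r * d) * prod_list v = r * (c * d * prod_list u)"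
    if "c \<in> {a, b}" "d \<in> {a, b}" for c d
  proof -
    have rc: "r * c * r = r * c" and rd: "r * d * r = r * d" using that r by auto
    have "r * c * (r * d) * prod_list v = r * c * (r * d * r) * prod_list v" by (simp only: rd)
    also have "\<dots> = r * c * (r * d) * (r * prod_list v)" by (simp only: mult.assoc)
    also have "\<dots> = r * c * (r * d * r) * prod_list u" unfolding u(3) by (simp only: mult.assoc)
    also have "\<dots> = (r * c * r) * d * prod_list u" unfolding rd by (simp only: mult.assoc)
    finally show ?thesis unfolding rc by (simp only: mult.assoc)
  qed
  note this[of a b] this[of b a]
  moreover have "a * b * prod_list u = b * a * prod_list u"
    using w u v unfolding word_commuting_def by simp
  ultimately show "r * a * (r * b) * prod_list v = r * b * (r * a) * prod_list v" by simp
qed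

lemma word_commuting_topnil_add:
  fixes a b :: "'a::real_normed_algebra_1"
  assumes w: "word_commuting k a b" and t: "topnil a" "topnil b"
  shows "topnil (a + b)"
proof -
  \<comment> \<open>Quantifying over words of every length makes \<open>V\<close> stable under left
    multiplication by \<open>a\<close> and \<open>b\<close>.\<close>
  define V where "V = {y. \<forall>w. set w \<subseteq> {a, b} \<longrightarrow> a * b * prod_list w * y = b * a * prod_list w * y}"
  have V: "y \<in> V" if "\<And>w. set w \<subseteq> {a, b} \<Longrightarrow> a * b * prod_list w * y = b * a * prod_list w * y" for y
    using that by (simp add: V_def)
  have VD: "a * b * prod_list w * y = b * a * prod_list w * y" if "y \<in> V" "set w \<subseteq> {a, b}" for y w
    using that by (simp add: V_def)
  have mult: "c * y \<in> V" if "y \<in> V" "c \<in> {a, b}" for c y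
  proof (rule V)
    fix w assume "set w \<subseteq> {a, b}"
    then show "a * b * prod_list w * (c * y) = b * a * prod_list w * (c * y)"
      using VD[OF that(1), of "w @ [c]"] that(2) by (simp add: mult.assoc)
  qed
  have add: "y + z \<in> V" if "y \<in> V" "z \<in> V" for y z
    using VD that by (intro V) (simp only: distrib_left)
  \<comment> \<open>\<open>(a + b) ^ j\<close> is the sum of all words of length \<open>j\<close>,
    so membership can be tested word by word.\<close>
  have sum_power: "(a + b) ^ j * y \<in> V"
    if "\<And>w. length w = j \<Longrightarrow> set w \<subseteq> {a, b} \<Longrightarrow> prod_list w * y \<in> V" for j y
    using that
  proof (induction j arbitrary: y)
    case 0
    then show ?case by (metis bot.extremum empty_set list.size(3) mult_1 power_0 prod_list.Nil)
  next
    case (Suc j)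
    have "(a + b) ^ j * (c * y) \<in> V" if "c \<in> {a, b}" for c
    proof (rule Suc.IH)
      fix w :: "'a list" assume "length w = j" "set w \<subseteq> {a, b}"
      then show "prod_list w * (c * y) \<in> V"
        using Suc.prems[of "w @ [c]"] that by (simp add: mult.assoc)
    qed
    from add[OF this[of a] this[of b]] show ?case
      by (simp only: power_Suc2 mult.assoc distrib_left distrib_right) simp
  qed
  have "(a + b) ^ k * 1 \<in> V"
  proof (rule sum_power, rule V)
    fix v u :: "'a list"
    assume "length v = k" and vs: "set v \<subseteq> {a, b}" and us: "set u \<subseteq> {a, b}"
    \<comment> \<open>The hypothesis concerns the \<open>k\<close> letters directly after
      \<open>a * b\<close>; the length of \<open>v\<close> guarantees that they exist.\<close>
    define u1 u2 where "u1 = take k (u @ v)" and "u2 = drop k (u @ v)"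
    have "length u1 = k" "set u1 \<subseteq> {a, b}"
      using \<open>length v = k\<close> vs us set_take_subset[of k "u @ v"] by (auto simp: u1_def)
    then have "a * b * prod_list u1 = b * a * prod_list u1"
      using w unfolding word_commuting_def by blast
    then have "a * b * prod_list u1 * prod_list u2 = b * a * prod_list u1 * prod_list u2" by simp
    moreover have "prod_list u1 * prod_list u2 = prod_list u * prod_list v"
      by (simp add: u1_def u2_def flip: prod_list.append del: take_append drop_append)
    ultimately show "a * b * prod_list u * (prod_list v * 1) = b * a * prod_list u * (prod_list v * 1)"
      by (simp add: mult.assoc)
  qed
  then have "(a + b) ^ k \<in> V" by simp
  moreover have "a * b * y = b * a * y" if "y \<in> V" for y
    using VD[OF that, of "[]"] by simp
  ultimately show ?thesis
    using topnil_add_module[OF t, where V = V and k = k] add mult[of _ a] mult[of _ b] by simp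
qed

text \<open>Only the constant word \<open>a ^ k\<close> is used: multiplying by \<open>x ^ k\<close>
  on the right gives commutation on \<open>p\<close>, and the vanishing of \<open>r * b * p\<close>
  follows. For this \<open>k\<close> must be positive, as \<open>a ^ 0 * x ^ 0\<close> is not
  \<open>p\<close>.\<close>

lemma word_commuting_gpiH:
  fixes a b :: "'a::complex_banach_algebra_1"
  assumes w: "word_commuting k a b" and k: "k > 0" and x: "is_gpiH_inverse a x"
  defines "p \<equiv> a * x" and "r \<equiv> 1 - a * x"
  shows "a * b * p = b * a * p" and "p * b * p = b * p"
    and "r * r = r" "r * a * r = r * a" "r * b * r = r * b"
proof -
  note i = gpiH_inverse_idempotent[OF x]
  obtain j where j: "k = Suc j" using k gr0_implies_Suc by blast
  have "a * b * a ^ k = b * a * a ^ k"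
    using w[unfolded word_commuting_def, rule_format, of "replicate k a"]
    by (simp add: prod_list_replicate set_replicate_conv_if)
  then have "a * b * (a ^ k * x ^ k) = b * a * (a ^ k * x ^ k)"
    by (simp flip: mult.assoc)
  then show 1: "a * b * p = b * a * p"
    using gpiH_inverse_powers(3)[OF x, of j] by (simp add: p_def j)
  have rr: "r * r = r" using i(1) by (simp add: r_def algebra_simps)
  have ar: "commute a r" unfolding r_def using i(4) by (intro commute_intros)
  have "r * b * p = 0"
    using topnil_corner_vanish[OF x rr ar, of b] gpiH_inverse_topnil(1)[OF x] 1
    by (simp add: p_def r_def)
  then show 2: "p * b * p = b * p" by (simp add: r_def p_def left_diff_distrib)
  show "r * r = r" by (rule rr)
  show "r * a * r = r * a" by (metis ar commuteD mult.assoc rr)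
  show "r * b * r = r * b" using 2 by (simp add: r_def p_def left_diff_distrib right_diff_distrib)
qed

lemma word_commuting_quasiperiodic_add:
  fixes a b :: "'a::complex_banach_algebra_1"
  assumes w: "word_commuting k a b" and k: "k > 0" and a: "topnil a" and b: "quasiperiodic b"
  shows "quasiperiodic (a + b)"
proof -
  obtain y where y: "is_gpiH_inverse b y"
    using quasiperiodic_imp_gpiH_invertible[OF b] unfolding gpiH_invertible_def by blast
  define q r where "q = b * y" and "r = 1 - b * y"
  note i = gpiH_inverse_idempotent[OF y, folded q_def]
  \<comment> \<open>The word condition is symmetric, so \<open>a\<close> is triangular with respect
    to the idempotent of \<open>b\<close>.\<close>
  note c = word_commuting_gpiH[OF word_commuting_sym[OF w] k y, folded q_def r_def]
  have qb: "q * b * q = b * q"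
  proof -
    have "commute b q" unfolding q_def using i(4) by (intro commute_intros)
    then show ?thesis by (metis commuteD i(1) mult.assoc)
  qed
  have "quasiperiodic (b * q + a * q)"
  proof (rule quasiperiodic_add_topnil)
    show "quasiperiodic (b * q)" using quasiperiodic_triangular[OF i(1) qb] b by blast
    show "topnil (a * q)" using topnil_corner_right[OF a c(2)] .
    have "b * q * (a * q) = b * a * q" "a * q * (b * q) = a * b * q"
      by (metis c(2) mult.assoc) (metis qb mult.assoc)
    then show "commute (b * q) (a * q)" using c(1) by (simp add: commute_def)
  qed
  then have "quasiperiodic ((a + b) * q)" by (simp add: distrib_right add.commute)
  moreover have "quasiperiodic (r * (a + b))"
  proof -
    have "topnil (r * b)"
      using topnil_swap[of b r] gpiH_inverse_topnil(1)[OF y] by (simp add: r_def q_def)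
    moreover have "topnil (r * a)" using topnil_corner_left[OF a c(5)] .
    moreover have "word_commuting k (r * a) (r * b)"
      using word_commuting_corner[OF w c(3) c(5) c(4)] .
    ultimately show ?thesis
      using word_commuting_topnil_add topnil_imp_quasiperiodic by (metis distrib_left)
  qed
  moreover have "q * (a + b) * q = (a + b) * q"
    using c(2) qb by (simp add: distrib_left distrib_right)
  ultimately show ?thesis
    using quasiperiodic_triangular[OF i(1)] by (simp add: r_def q_def)
qed

theorem theorem3p11:
  fixes a b :: "'a::complex_banach_algebra_1" and k :: nat
  assumes "k > 0"
    and "gpiH_invertible a" and "gpiH_invertible b"
    and "\<forall>\<alpha>s. length \<alpha>s = k \<and> set \<alpha>s \<subseteq> {a, b} \<longrightarrow>
           a * b * prod_list \<alpha>s = b * a * prod_list \<alpha>s"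
  shows "gpiH_invertible (1 + gpiH_inv a * b) \<longleftrightarrow> gpiH_invertible (a + b)"
proof -
  define x where "x = gpiH_inv a"
  define p r where "p = a * x" and "r = 1 - a * x"
  define s t where "s = a + b" and "t = 1 + x * b"
  have x: "is_gpiH_inverse a x" unfolding x_def using assms(2) by (rule gpiH_inv_inverse)
  have w: "word_commuting k a b" using assms(4) by (simp add: word_commuting_def)
  note i = gpiH_inverse_idempotent[OF x, folded p_def]
  note c = word_commuting_gpiH[OF w assms(1) x, folded p_def r_def]
  have xa: "x * a = p" using commuteD[OF i(4)] by (simp add: p_def)
  have pa: "p * a = a * p" using xa by (simp add: p_def mult.assoc)
  have px: "p * x = x" using i(3) by (simp add: p_def)
  have sp: "p * s * p = s * p"
  proof -
    have "p * a * p = a * p" using pa i(1) by (simp add: mult.assoc)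
    with c(2) show ?thesis by (simp add: s_def distrib_left distrib_right)
  qed
  have tp: "p * t * p = t * p"
    using i(1) px by (simp add: t_def distrib_left distrib_right flip: mult.assoc)
  have "quasiperiodic (r * s)"
  proof -
    have "topnil (r * a)"
      using topnil_swap[of a r] gpiH_inverse_topnil(1)[OF x] by (simp add: r_def)
    moreover have "quasiperiodic (r * b)"
      using quasiperiodic_triangular[OF i(1) c(2)] assms(3)
      by (simp add: r_def p_def gpiH_invertible_iff_quasiperiodic)
    ultimately show ?thesis unfolding s_def distrib_left
      using word_commuting_quasiperiodic_add[OF word_commuting_corner[OF w c(3-5)] assms(1)] by blast
  qed
  then have s: "quasiperiodic s \<longleftrightarrow> quasiperiodic (s * p)"
    using quasiperiodic_triangular[OF i(1) sp] by (simp add: r_def p_def)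
  \<comment> \<open>\<open>r * x = 0\<close> removes the term with \<open>b\<close>; what remains is
    an idempotent, hence quasiperiodic.\<close>
  have "r * t = r"
    using px by (simp add: r_def t_def p_def distrib_left left_diff_distrib flip: mult.assoc)
  then have t: "quasiperiodic t \<longleftrightarrow> quasiperiodic (t * p)"
    using quasiperiodic_triangular[OF i(1) tp] idempotent_imp_quasiperiodic[OF c(3)]
    by (simp add: r_def p_def)
  have xs: "x * (s * p) = t * p"
    by (simp add: s_def t_def distrib_left distrib_right xa i(1) flip: mult.assoc)
  have as: "a * (t * p) = s * p"
  proof -
    have "a * (t * p) = a * p + p * b * p" by (simp add: t_def p_def distrib_left distrib_right mult.assoc)
    then show ?thesis by (simp add: c(2) s_def distrib_right)
  qed
  have sx: "s * p * x = t * p"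
  proof -
    \<comment> \<open>Commutation of \<open>a\<close> and \<open>b\<close> on \<open>p\<close>
      passes to \<open>x\<close>: insert \<open>p = x * a\<close> in front of \<open>b * x\<close>,
      then exchange \<open>a\<close> and \<open>b\<close>.\<close>
    have "x * b * p = b * x"
    proof -
      have "b * x = p * b * x" using c(2) px by (metis mult.assoc)
      also have "\<dots> = x * (a * b * p) * x" using px xa by (simp add: mult.assoc) (metis mult.assoc)
      also have "\<dots> = x * b * (a * p * x)" unfolding c(1) by (simp only: mult.assoc)
      also have "a * p * x = p" using px by (simp add: p_def mult.assoc)
      finally show ?thesis ..
    qed
    then show ?thesis
      using px by (simp add: s_def t_def distrib_right mult.assoc p_def[symmetric])
  qed
  have ta: "t * p * a = s * p"
  proof -
    have "t * p * a = a * p + x * (b * a * p)" by (simp add: t_def distrib_right mult.assoc pa)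
    also have "x * (b * a * p) = p * b * p" unfolding c(1)[symmetric] by (simp add: xa flip: mult.assoc)
    finally show ?thesis by (simp add: c(2) s_def distrib_right)
  qed
  have "quasiperiodic (s * p) \<longleftrightarrow> quasiperiodic (t * p)"
  proof
    assume "quasiperiodic (s * p)"
    from quasiperiodic_mult[OF gpiH_inverse_topnil(3)[OF x] this] show "quasiperiodic (t * p)"
      by (simp add: commute_def xs sx)
  next
    assume "quasiperiodic (t * p)"
    from quasiperiodic_mult[OF gpiH_inverse_topnil(2)[OF x] this] show "quasiperiodic (s * p)"
      by (simp add: commute_def as ta)
  qed
  with s t show ?thesis
    by (simp add: gpiH_invertible_iff_quasiperiodic s_def t_def x_def)
qed

end
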